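(* Let $b$ be a positive integer. For $0<t<1$ put $q=\frac{1-t}{1+t}$ and \[ f_b(t):=2\sum_{n=0}^\infty (-1)^n q^{n^2+bn}. \] Let $f_b(t)\sim\sum_{n=0}^\infty a_n t^n$ be the asymptotic expansion of $f_b$ as $t\to 0^+$ (see context). If $b\equiv 1,2\pmod 4$, then $a_n>0$ for all sufficiently large $n$; if $b\equiv 0,3\pmod 4$, then $a_n<0$ for all sufficiently large $n$. In particular, for every positive integer $b$ the coefficients $a_n$ all have the same sign for sufficiently large $n$.
   Context: The function $f_b(t)$ (a partial theta function) admits an asymptotic power series expansion $f_b(t)\sim\sum_{n\ge0}a_nt^n$ as $t\to0^+$ with real coefficients $a_n$ depending on $b$. This means that for every $N\ge 0$ one has $f_b(t)-\sum_{n=0}^{N}a_nt^n=O(t^{N+1})$ as $t\to 0^+$; the existence of such an expansion is a known result of Berndt and Kim, and the coefficients $a_n$ are uniquely determined by $f_b$. *)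

theory Defs
  imports Complex_Main "HOL-Library.Landau_Symbols"
begin

definition qpar :: "real \<Rightarrow> real" where
  "qpar t = (1 - t) / (1 + t)"

definition f_theta :: "nat \<Rightarrow> real \<Rightarrow> real" where
  "f_theta b t = 2 * (\<Sum>n. (-1) ^ n * qpar t ^ (n^2 + b * n))"

definition asymp_expansion_at_0 :: "(real \<Rightarrow> real) \<Rightarrow> (nat \<Rightarrow> real) \<Rightarrow> bool" where
  "asymp_expansion_at_0 g a \<longleftrightarrow>
     (\<forall>N. (\<lambda>t. g t - (\<Sum>n\<le>N. a n * t ^ n)) \<in> O[at_right 0](\<lambda>t. t ^ (N + 1)))"

end

theory Submission
  imports Defs "HOL-Computational_Algebra.Formal_Power_Series" "HOL-Computational_Algebra.Polynomial"
begin

text \<open>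
  Write \<open>q = exp (-s)\<close>. Repeated Euler transformation of the alternating series replaces it, up to an
  error \<open>O(s ^ k)\<close> with \<open>k\<close> as large as desired, by a finite combination of its first terms, each of
  which is an analytic function of \<open>t\<close>. Hence \<open>a\<^sub>n = L (\<lambda>x. p\<^sub>n (- (x\<^sup>2 + b x)))\<close>, where
  \<open>((1 + t) / (1 - t)) ^ z = (\<Sum>n. p\<^sub>n z t ^ n)\<close> and \<open>L\<close> is the functional on polynomials with
  \<open>L g + L (\<lambda>x. g (x + 1)) = 2 g 0\<close>. Completing the square and shifting \<open>x\<close> by \<open>m = b div 2\<close> turns this
  into \<open>(-1) ^ m\<close> times \<open>L g - 2 (\<Sum>i<m. (-1) ^ i g i)\<close> with \<open>g y = p\<^sub>n (b\<^sup>2/4 - (y + \<beta>)\<^sup>2)\<close>, \<open>\<beta> = b/2 - m\<close>.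

  If \<open>b\<close> is even, then \<open>g\<close> is even, so \<open>L g = g 0\<close>, and what remains is \<open>-p\<^sub>n (m\<^sup>2)\<close> plus terms
  \<open>\<plusminus> 2 p\<^sub>n (m\<^sup>2 - i\<^sup>2)\<close> that grow as lower powers of \<open>n\<close>. If \<open>b\<close> is odd, then \<open>L g\<close> is a combination
  with nonnegative coefficients of the numbers \<open>(-1) ^ k L (\<lambda>y. (y + 1/2) ^ (2 k))\<close>, which are
  the derivatives of \<open>sec (u/2)\<close> of order \<open>2 k\<close> at \<open>0\<close>: they are positive and grow factorially, while the
  finite sum grows polynomially.
\<close>

section \<open>Mittag-Leffler polynomials\<close>

text \<open>These are the coefficients of \<open>((1 + t) / (1 - t)) powr z\<close> in powers of \<open>t\<close>;
  the recurrence expresses the differential equation \<open>(1 - t\<^sup>2) y' = 2 z y\<close>.\<close>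

fun ml_coeff :: "nat \<Rightarrow> real \<Rightarrow> real" where
  "ml_coeff 0 z = 1"
| "ml_coeff (Suc 0) z = 2 * z"
| "ml_coeff (Suc (Suc n)) z = (real n * ml_coeff n z + 2 * z * ml_coeff (Suc n) z) / real (n + 2)"

text \<open>A crude geometric bound: it makes the generating series converge for
  \<open>\<bar>t\<bar> < 1 / (1 + 2 * \<bar>z\<bar>)\<close>, which is enough near
  \<open>t = 0\<close>.\<close>

lemma abs_ml_coeff_le: "\<bar>ml_coeff n z\<bar> \<le> (1 + 2 * \<bar>z\<bar>) ^ n"
proof (induction n z rule: ml_coeff.induct)
  case (3 n z)
  define A where "A = 1 + 2 * \<bar>z\<bar>"
  have A: "A \<ge> 1" by (simp add: A_def)
  have "\<bar>real n * ml_coeff n z + 2 * z * ml_coeff (Suc n) z\<bar>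
      \<le> real n * \<bar>ml_coeff n z\<bar> + 2 * \<bar>z\<bar> * \<bar>ml_coeff (Suc n) z\<bar>"
    by (rule order_trans[OF abs_triangle_ineq]) (simp add: abs_mult)
  also have "\<dots> \<le> real n * A ^ n + (A - 1) * A ^ Suc n"
    using 3 by (intro add_mono mult_mono) (auto simp: A_def)
  also have "\<dots> \<le> real n * A ^ Suc (Suc n) + A * A ^ Suc n"
    using A by (intro add_mono mult_left_mono mult_right_mono power_increasing) auto
  also have "\<dots> \<le> real (n + 2) * A ^ Suc (Suc n)"
    using A by (simp add: algebra_simps)
  finally have "\<bar>real n * ml_coeff n z + 2 * z * ml_coeff (Suc n) z\<bar> / real (n + 2)
      \<le> A ^ Suc (Suc n)"
    by (subst pos_divide_le_eq) (auto simp: mult.commute)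
  then show ?case by (simp add: A_def)
qed auto

lemma summable_ml_coeff:
  assumes "\<bar>t\<bar> * (1 + 2 * \<bar>z\<bar>) < 1"
  shows "summable (\<lambda>n. ml_coeff n z * t ^ n)"
proof (rule summable_comparison_test')
  show "summable (\<lambda>n. ((1 + 2 * \<bar>z\<bar>) * \<bar>t\<bar>) ^ n)"
    using assms by (intro summable_geometric) (simp add: abs_mult mult.commute)
  show "norm (ml_coeff n z * t ^ n) \<le> ((1 + 2 * \<bar>z\<bar>) * \<bar>t\<bar>) ^ n" for n
    using abs_ml_coeff_le[of n z]
    by (simp add: abs_mult power_mult_distrib power_abs mult_right_mono)
qed

text \<open>Comparing coefficients in \<open>F' = t\<^sup>2 F' + 2 z F\<close> gives exactly the
  recurrence of \<open>ml_coeff\<close>.\<close>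

lemma ml_coeff_series_deriv:
  assumes "\<bar>t\<bar> * (1 + 2 * \<bar>z\<bar>) < 1"
  defines "F \<equiv> \<lambda>t. \<Sum>n. ml_coeff n z * t ^ n"
  shows "(F has_real_derivative 2 * z * F t / (1 - t\<^sup>2)) (at t)"
proof -
  let ?A = "1 + 2 * \<bar>z\<bar>"
  have "\<bar>t\<bar> < 1 / ?A" using assms(1) by (simp add: pos_less_divide_eq)
  then obtain K where K: "\<bar>t\<bar> < K" "K < 1 / ?A" using dense by blast
  then have K': "K > 0" "\<bar>K\<bar> * ?A < 1" by (auto simp: pos_less_divide_eq)
  let ?c = "\<lambda>n. ml_coeff n z"
  have "\<bar>t\<bar> * 1 \<le> \<bar>t\<bar> * ?A" by (intro mult_left_mono) auto
  then have t1: "\<bar>t\<bar> < 1" using assms(1) by linarith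
  define F' where "F' = (\<Sum>n. diffs ?c n * t ^ n)"
  have deriv: "(F has_real_derivative F') (at t)"
    unfolding F_def F'_def
    using termdiffs_strong[OF summable_ml_coeff[OF K'(2)], of t] K K'(1) by simp
  have sD: "summable (\<lambda>n. diffs ?c n * t ^ n)"
  proof (rule termdiff_converges[of t K])
    fix x :: real assume "norm x < K"
    then have "\<bar>x\<bar> * ?A \<le> \<bar>K\<bar> * ?A" by (intro mult_right_mono) auto
    then show "summable (\<lambda>n. ?c n * x ^ n)"
      using K'(2) by (intro summable_ml_coeff) simp
  qed (use K in auto)
  have D: "(\<lambda>n. diffs ?c n * t ^ n) sums F'"
    unfolding F'_def using sD by (rule summable_sums)
  have "(\<lambda>n. real n * ?c n * t ^ (n - Suc 0)) sums F'"
    unfolding F'_def using diffs_equiv[OF sD] by simp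
  \<comment> \<open>After multiplication by \<open>t\<^sup>2\<close> the term of index
    \<open>n\<close> has degree \<open>n + 1\<close>. It is paired with the term of index
    \<open>n + 1\<close> of \<open>2 z F\<close>, whose constant term \<open>2 z\<close> is split
    off and put back at the end.\<close>
  from sums_mult[OF this, of "t\<^sup>2"] have "(\<lambda>n. t\<^sup>2 * (real n * ?c n * t ^ (n - Suc 0))) sums (t\<^sup>2 * F')" .
  also have "(\<lambda>n. t\<^sup>2 * (real n * ?c n * t ^ (n - Suc 0))) = (\<lambda>n. real n * ?c n * t ^ Suc n)"
  proof
    fix n show "t\<^sup>2 * (real n * ?c n * t ^ (n - Suc 0)) = real n * ?c n * t ^ Suc n"
      by (cases n) (auto simp: power2_eq_square)
  qed
  finally have V: "(\<lambda>n. real n * ?c n * t ^ Suc n) sums (t\<^sup>2 * F')" .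
  have "(\<lambda>n. ?c n * t ^ n) sums F t"
    unfolding F_def using summable_ml_coeff[OF assms(1)] by (rule summable_sums)
  from sums_mult[OF this, of "2 * z"]
  have "(\<lambda>n. 2 * z * (?c (Suc n) * t ^ Suc n)) sums (2 * z * F t - 2 * z)"
    by (subst sums_Suc_iff) simp
  from sums_add[OF V this]
  have "(\<lambda>n. real n * ?c n * t ^ Suc n + 2 * z * (?c (Suc n) * t ^ Suc n))
      sums (t\<^sup>2 * F' + (2 * z * F t - 2 * z))" .
  also have "(\<lambda>n. real n * ?c n * t ^ Suc n + 2 * z * (?c (Suc n) * t ^ Suc n))
      = (\<lambda>n. diffs ?c (Suc n) * t ^ Suc n)"
  proof
    fix n
    have "real (Suc (Suc n)) * ?c (Suc (Suc n)) = real n * ?c n + 2 * z * ?c (Suc n)"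
      by simp
    then show "real n * ?c n * t ^ Suc n + 2 * z * (?c (Suc n) * t ^ Suc n)
        = diffs ?c (Suc n) * t ^ Suc n"
      unfolding diffs_def by (simp only: distrib_right mult.assoc)
  qed
  finally have "(\<lambda>n. diffs ?c n * t ^ n) sums (t\<^sup>2 * F' + (2 * z * F t - 2 * z) + 2 * z)"
    by (subst (asm) sums_Suc_iff) (simp add: diffs_def)
  with D have "F' = t\<^sup>2 * F' + 2 * z * F t"
    using sums_unique2[of _ F' "t\<^sup>2 * F' + (2 * z * F t - 2 * z) + 2 * z"] by auto
  moreover have "1 - t\<^sup>2 \<noteq> 0"
    using t1 by (metis abs_square_less_1 less_irrefl right_minus_eq)
  ultimately have "F' = 2 * z * F t / (1 - t\<^sup>2)"
    by (simp add: field_simps)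
  with deriv show ?thesis by simp
qed

text \<open>This is \<open>s\<close> in \<open>q = exp (-s)\<close>. Thus
  \<open>exp (z * neg_log_q t)\<close> is \<open>((1 + t) / (1 - t)) powr z\<close>, and powers of
  \<open>q\<close> are the case of negative \<open>z\<close>.\<close>

definition neg_log_q :: "real \<Rightarrow> real" where
  "neg_log_q t = - ln (qpar t)"

lemma neg_log_q_deriv:
  assumes "\<bar>t\<bar> < 1"
  shows "(neg_log_q has_real_derivative 2 / (1 - t\<^sup>2)) (at t)"
proof -
  have "1 + t > 0" "1 - t > 0" using assms by auto
  moreover have "1 - t\<^sup>2 \<noteq> 0"
    using assms by (metis abs_square_less_1 less_irrefl right_minus_eq)
  moreover have "(1 - t) / (1 + t) > 0" using calculation by simp
  ultimately show ?thesis
    unfolding neg_log_q_def qpar_def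
    by (auto intro!: derivative_eq_intros)
      (simp add: divide_simps power2_eq_square, simp add: algebra_simps)
qed

lemma neg_log_q_0 [simp]: "neg_log_q 0 = 0"
  by (simp add: neg_log_q_def qpar_def)

text \<open>The series and the exponential solve the same linear differential equation with value 1
  at 0, so their quotient \<open>G\<close> is constant.\<close>

lemma ml_coeff_sums:
  assumes "0 \<le> t" "\<bar>t\<bar> * (1 + 2 * \<bar>z\<bar>) < 1"
  shows "(\<lambda>n. ml_coeff n z * t ^ n) sums exp (z * neg_log_q t)"
proof -
  define F where "F = (\<lambda>t. \<Sum>n. ml_coeff n z * t ^ n)"
  define G where "G = (\<lambda>t. F t * exp (- z * neg_log_q t))"
  have small: "\<bar>u\<bar> * (1 + 2 * \<bar>z\<bar>) < 1" if "\<bar>u\<bar> \<le> \<bar>t\<bar>" for u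
    using assms(2) mult_right_mono[OF that, of "1 + 2 * \<bar>z\<bar>"] by linarith
  have small1: "\<bar>u\<bar> < 1" if "\<bar>u\<bar> \<le> \<bar>t\<bar>" for u
    using small[OF that] mult_left_mono[of 1 "1 + 2 * \<bar>z\<bar>" "\<bar>u\<bar>"] by simp
  have dG: "(G has_real_derivative 0) (at u)" if u: "\<bar>u\<bar> \<le> \<bar>t\<bar>" for u
  proof -
    have "((\<lambda>t. - z * neg_log_q t) has_real_derivative - z * (2 / (1 - u\<^sup>2))) (at u)"
      by (intro DERIV_cmult neg_log_q_deriv small1 u)
    then have e: "((\<lambda>t. exp (- z * neg_log_q t)) has_real_derivative
        exp (- z * neg_log_q u) * (- z * (2 / (1 - u\<^sup>2)))) (at u)"
      by (rule DERIV_fun_exp)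
    have f: "(F has_real_derivative 2 * z * F u / (1 - u\<^sup>2)) (at u)"
      unfolding F_def by (rule ml_coeff_series_deriv[OF small[OF u]])
    show ?thesis
      unfolding G_def by (rule DERIV_cong[OF DERIV_mult[OF f e]]) (simp add: algebra_simps)
  qed
  have "G t = G 0"
  proof (cases "t = 0")
    case False
    show ?thesis
    proof (rule DERIV_isconst_end[where f = G])
      show "continuous_on {0..t} G"
        by (intro continuous_at_imp_continuous_on ballI, rule DERIV_isCont, rule dG) auto
    qed (use dG False assms(1) in auto)
  qed simp
  also have "G 0 = 1"
    by (simp add: G_def F_def powser_zero)
  finally have "F t = exp (z * neg_log_q t)"
    by (simp add: G_def exp_minus field_simps)
  then show ?thesis
    using summable_sums[OF summable_ml_coeff[OF assms(2)]] by (simp add: F_def)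
qed

lemma exp_neg_log_q_expansion: "asymp_expansion_at_0 (\<lambda>t. exp (z * neg_log_q t)) (\<lambda>n. ml_coeff n z)"
  unfolding asymp_expansion_at_0_def
proof (intro allI bigoI)
  fix N
  define A where "A = 1 + 2 * \<bar>z\<bar>"
  have A: "A \<ge> 1" by (simp add: A_def)
  show "\<forall>\<^sub>F t in at_right 0. norm (exp (z * neg_log_q t) - (\<Sum>n\<le>N. ml_coeff n z * t ^ n))
       \<le> (2 * A ^ (N + 1)) * norm (t ^ (N + 1))"
    unfolding eventually_at_right_field
  \<comment> \<open>For \<open>t < 1 / (2 * A)\<close> the tail is dominated by a geometric series
    of ratio less than \<open>1/2\<close>, whence the factor 2 in the bound.\<close>
  proof (intro exI[of _ "1 / (2 * A)"] conjI allI impI)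
    fix t :: real assume t: "0 < t" "t < 1 / (2 * A)"
    then have tA: "t * A < 1 / 2" using A by (simp add: field_simps)
    let ?f = "\<lambda>n. ml_coeff n z * t ^ n"
    have s: "?f sums exp (z * neg_log_q t)"
      using tA t by (intro ml_coeff_sums) (simp_all add: A_def)
    then have s': "(\<lambda>n. ?f (n + Suc N)) sums (exp (z * neg_log_q t) - (\<Sum>n<Suc N. ?f n))"
      by (subst sums_iff_shift) simp
    have g: "(\<lambda>n. (t * A) ^ n * (t * A) ^ Suc N) sums (1 / (1 - t * A) * (t * A) ^ Suc N)"
      using tA t A by (intro sums_mult2 geometric_sums) auto
    have "\<bar>exp (z * neg_log_q t) - (\<Sum>n<Suc N. ?f n)\<bar> \<le> 1 / (1 - t * A) * (t * A) ^ Suc N"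
    proof -
      have "\<bar>?f (n + Suc N)\<bar> \<le> (t * A) ^ n * (t * A) ^ Suc N" for n
      proof -
        have "\<bar>?f (n + Suc N)\<bar> \<le> A ^ (n + Suc N) * t ^ (n + Suc N)"
          using abs_ml_coeff_le[of "n + Suc N" z] t
          by (simp add: abs_mult A_def mult_right_mono)
        then show ?thesis by (simp add: power_mult_distrib power_add mult_ac)
      qed
      then have "norm (\<Sum>n. ?f (n + Suc N)) \<le> (\<Sum>n. (t * A) ^ n * (t * A) ^ Suc N)"
        by (intro norm_suminf_le sums_summable[OF g]) auto
      then show ?thesis using s' g by (simp add: sums_iff)
    qed
    also have "\<dots> \<le> 2 * (t * A) ^ Suc N"
      using tA t A by (intro mult_right_mono) (auto simp: field_simps)
    finally show "norm (exp (z * neg_log_q t) - (\<Sum>n\<le>N. ?f n)) \<le> (2 * A ^ (N + 1)) * norm (t ^ (N + 1))"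
      using t by (simp add: lessThan_Suc_atMost power_mult_distrib mult_ac abs_mult power_abs)
  qed (use A in auto)
qed

section \<open>Monotonicity and growth of the Mittag-Leffler polynomials\<close>

lemma ml_coeff_mono: "0 \<le> z \<Longrightarrow> z \<le> w \<Longrightarrow> 0 \<le> ml_coeff n z \<and> ml_coeff n z \<le> ml_coeff n w"
  by (induction n z rule: ml_coeff.induct)
    (auto intro!: divide_right_mono add_mono mult_mono add_nonneg_nonneg divide_nonneg_nonneg)

text \<open>The recurrence telescopes. On generating functions this is
  \<open>(1 + t) y' = 2 z y / (1 - t)\<close>.\<close>

lemma sum_ml_coeff_eq:
  "real n * ml_coeff n z + real (Suc n) * ml_coeff (Suc n) z = 2 * z * (\<Sum>k\<le>n. ml_coeff k z)"
proof (induction n)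
  case (Suc n)
  have "real (Suc (Suc n)) * ml_coeff (Suc (Suc n)) z
      = real n * ml_coeff n z + 2 * z * ml_coeff (Suc n) z" by simp
  with Suc show ?case by (simp add: algebra_simps del: ml_coeff.simps)
qed simp

text \<open>Raising \<open>z\<close> by 1 multiplies the generating function by
  \<open>(1 + t) / (1 - t) = 1 + 2 t / (1 - t)\<close>.\<close>

lemma ml_coeff_Suc_arg: "ml_coeff n (z + 1) = ml_coeff n z + 2 * (\<Sum>k<n. ml_coeff k z)"
proof (induction n z rule: ml_coeff.induct)
  case (3 n z)
  have "real n * ml_coeff n z + real (Suc n) * ml_coeff (Suc n) z = 2 * z * (\<Sum>k\<le>n. ml_coeff k z)"
    by (rule sum_ml_coeff_eq)
  with 3 show ?case
    by (simp add: divide_simps lessThan_Suc_atMost[symmetric]) (simp add: algebra_simps)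
qed auto

lemma ml_coeff_0_right: "ml_coeff n 0 = (if n = 0 then 1 else 0)"
  by (induction n "0::real" rule: ml_coeff.induct) auto

text \<open>By \<open>ml_coeff_Suc_arg\<close>, each unit step in the argument costs one summation
  over the index, hence one power of \<open>n\<close>.\<close>

lemma ml_coeff_le: "ml_coeff n (real M + 1) \<le> 2 ^ (M + 1) * (real n + 1) ^ M"
proof (induction M arbitrary: n)
  case 0
  show ?case
    using ml_coeff_Suc_arg[of n 0]
    by (cases n) (auto simp: ml_coeff_0_right lessThan_Suc_eq_insert_0 sum.reindex)
next
  case (Suc M)
  have "ml_coeff n (real (Suc M) + 1) \<le> 2 * (\<Sum>k\<le>n. ml_coeff k (real M + 1))"
    using ml_coeff_Suc_arg[of n "real M + 1"] ml_coeff_mono[of "real M + 1" "real M + 1" n]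
    by (simp add: add.commute flip: lessThan_Suc_atMost)
  also have "\<dots> \<le> 2 * (\<Sum>k\<le>n. 2 ^ (M + 1) * (real n + 1) ^ M)"
    by (intro mult_left_mono sum_mono order_trans[OF Suc] power_mono) auto
  also have "\<dots> = 2 ^ (Suc M + 1) * (real n + 1) ^ Suc M" by simp
  finally show ?case .
qed

text \<open>The binomial is the coefficient of \<open>t ^ n\<close> in
  \<open>(1 - t) powr (- (M + 1))\<close>, which \<open>((1 + t) / (1 - t)) ^ (M + 1)\<close>
  dominates coefficientwise.\<close>

lemma ml_coeff_ge: "ml_coeff n (real M + 1) \<ge> real ((M + n) choose n)"
proof (induction M arbitrary: n)
  case 0
  show ?case
    using ml_coeff_Suc_arg[of n 0]
    by (cases n) (auto simp: ml_coeff_0_right lessThan_Suc_eq_insert_0 sum.reindex)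
next
  case (Suc M)
  have "real ((Suc M + n) choose n) = (\<Sum>k\<le>n. real ((M + k) choose k))"
    using sum_choose_lower[of M n] by (simp flip: of_nat_sum)
  also have "\<dots> \<le> (\<Sum>k\<le>n. ml_coeff k (real M + 1))" by (intro sum_mono Suc)
  also have "\<dots> \<le> ml_coeff n (real M + 1) + 2 * (\<Sum>k<n. ml_coeff k (real M + 1))"
    using sum_nonneg[of "{..<n}" "\<lambda>k. ml_coeff k (real M + 1)"] ml_coeff_mono[of "real M + 1" "real M + 1"]
    by (simp flip: lessThan_Suc_atMost)
  also have "\<dots> = ml_coeff n (real (Suc M) + 1)"
    using ml_coeff_Suc_arg[of n "real M + 1"] by (simp add: add_ac)
  finally show ?case .
qed

text \<open>The Mittag-Leffler polynomial expanded around \<open>c\<close>. Having it as a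
  \<open>poly\<close> gives access to its degree and to its coefficients, which are nonnegative for
  \<open>c \<ge> 0\<close>.\<close>

fun ml_poly :: "real \<Rightarrow> nat \<Rightarrow> real poly" where
  "ml_poly c 0 = 1"
| "ml_poly c (Suc 0) = [:2 * c, 2:]"
| "ml_poly c (Suc (Suc n)) =
     smult (1 / real (n + 2)) (smult (real n) (ml_poly c n) + [:2 * c, 2:] * ml_poly c (Suc n))"

lemma poly_ml_poly: "poly (ml_poly c n) u = ml_coeff n (c + u)"
  by (induction c n rule: ml_poly.induct) (simp_all add: algebra_simps add_divide_distrib)

lemma coeff_ml_poly_nonneg: "c \<ge> 0 \<Longrightarrow> coeff (ml_poly c n) k \<ge> 0"
proof (induction c n arbitrary: k rule: ml_poly.induct)
  case (3 c n)
  then show ?case by (auto simp: coeff_pCons split: nat.split intro!: divide_nonneg_nonneg add_nonneg_nonneg)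
qed (auto simp: coeff_pCons coeff_1 split: nat.split)

lemma degree_ml_poly: "degree (ml_poly c n) \<le> n"
proof (induction c n rule: ml_poly.induct)
  case (3 c n)
  have "degree ([:2 * c, 2:] * ml_poly c (Suc n)) \<le> Suc (Suc n)"
    using degree_mult_le[of "[:2 * c, 2:]" "ml_poly c (Suc n)"] 3 by simp
  moreover have "degree (smult (real n) (ml_poly c n)) \<le> Suc (Suc n)"
    using degree_smult_le[of "real n" "ml_poly c n"] 3 by simp
  ultimately have "degree (smult (real n) (ml_poly c n) + [:2 * c, 2:] * ml_poly c (Suc n)) \<le> Suc (Suc n)"
    by (rule degree_add_le[rotated])
  then show ?case
    using degree_smult_le order_trans unfolding ml_poly.simps by blast
qed auto

lemma coeff_ml_poly_n: "coeff (ml_poly c n) n = 2 ^ n / fact n"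
proof (induction c n rule: ml_poly.induct)
  case (3 c n)
  have "coeff (ml_poly c n) (Suc (Suc n)) = 0" "coeff (ml_poly c (Suc n)) (Suc (Suc n)) = 0"
    using degree_ml_poly[of c n] degree_ml_poly[of c "Suc n"] by (auto intro!: coeff_eq_0)
  then show ?case using 3 by (simp add: field_simps)
qed auto

section \<open>Euler transformation\<close>

definition fdiff :: "(real \<Rightarrow> real) \<Rightarrow> real \<Rightarrow> real" where
  "fdiff g x = g x - g (x + 1)"

text \<open>With the shift \<open>E\<close>, this is \<open>2 / (1 + E) = 1 / (1 - (1 - E) / 2)\<close> cut off after \<open>N\<close> terms
  of the geometric series, hence exact on polynomials of degree less than \<open>N\<close>.\<close>

definition euler_sum :: "nat \<Rightarrow> (real \<Rightarrow> real) \<Rightarrow> real \<Rightarrow> real" where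
  "euler_sum N g x = (\<Sum>j<N. (1/2) ^ j * (fdiff ^^ j) g x)"

lemma fdiff_funpow_Suc: "(fdiff ^^ Suc j) g x = (fdiff ^^ j) g x - (fdiff ^^ j) g (x + 1)"
  by (simp add: fdiff_def)

text \<open>With \<open>D = 1 - E\<close> one has \<open>1 + E = 2 - D\<close>, and
  \<open>(2 - D)\<close> times the sum of \<open>(D/2) ^ j\<close> over \<open>j < N\<close> equals
  \<open>2 - 2 (D/2) ^ N\<close>.\<close>

lemma euler_sum_step:
  "euler_sum N g x + euler_sum N g (x + 1) = 2 * g x - 2 * (1/2) ^ N * (fdiff ^^ N) g x"
proof (induction N)
  case (Suc N)
  have "euler_sum (Suc N) g y = euler_sum N g y + (1/2) ^ N * (fdiff ^^ N) g y" for y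
    by (simp add: euler_sum_def)
  moreover have "(fdiff ^^ N) g (x + 1) = (fdiff ^^ N) g x - (fdiff ^^ Suc N) g x"
    by (simp only: fdiff_funpow_Suc)
  ultimately show ?case
    using Suc by (simp add: distrib_left right_diff_distrib del: funpow.simps)
qed (simp add: euler_sum_def)

lemma fdiff_funpow_shift: "(fdiff ^^ j) (\<lambda>x. g (x + c)) = (\<lambda>x. (fdiff ^^ j) g (x + c))"
proof (induction j)
  case (Suc j)
  show ?case
    by (rule ext) (simp only: fdiff_funpow_Suc Suc add.assoc add.commute[of 1 c])
qed simp

lemma tendsto_fdiff_funpow:
  assumes "(\<lambda>n. g (real n)) \<longlonglongrightarrow> 0"
  shows "(\<lambda>n. (fdiff ^^ j) g (real n)) \<longlonglongrightarrow> 0"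
proof (induction j)
  case (Suc j)
  have "(\<lambda>n. (fdiff ^^ j) g (real n) - (fdiff ^^ j) g (real (Suc n))) \<longlonglongrightarrow> 0 - 0"
    using Suc LIMSEQ_Suc[OF Suc] by (intro tendsto_diff)
  then show ?case unfolding fdiff_funpow_Suc by (simp add: add.commute)
qed (use assms in simp)

text \<open>Since \<open>euler_sum N g\<close> tends to 0 along the integers, the alternating sum of
  its consecutive pairs telescopes to its value at 0. By \<open>euler_sum_step\<close> these pairs
  are \<open>2 g\<close> up to the \<open>N\<close>-th difference.\<close>

lemma euler_transform:
  assumes "(\<lambda>n. (-1) ^ n * g (real n)) sums S" and lim: "(\<lambda>n. g (real n)) \<longlonglongrightarrow> 0"
  shows "(\<lambda>n. (-1) ^ n * (2 * (1/2) ^ N * (fdiff ^^ N) g (real n))) sums (2 * S - euler_sum N g 0)"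
proof -
  let ?H = "euler_sum N g"
  have "(\<lambda>n. ?H (real n)) \<longlonglongrightarrow> (\<Sum>j<N. (1/2) ^ j * 0)"
    unfolding euler_sum_def by (intro tendsto_sum tendsto_mult tendsto_const tendsto_fdiff_funpow lim)
  then have "(\<lambda>n. ?H (real n)) \<longlonglongrightarrow> 0" by simp
  then have "(\<lambda>n. \<bar>(-1) ^ n * ?H (real n)\<bar>) \<longlonglongrightarrow> 0"
    by (simp add: abs_mult power_abs tendsto_rabs_zero)
  then have "(\<lambda>n. (-1) ^ n * ?H (real n)) \<longlonglongrightarrow> 0"
    by (simp add: tendsto_rabs_zero_iff)
  from telescope_sums'[OF this]
  have "(\<lambda>n. (-1) ^ n * (?H (real n) + ?H (real n + 1))) sums ?H 0"
    by (simp add: algebra_simps)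
  then have T: "(\<lambda>n. (-1) ^ n * (2 * g (real n) - 2 * (1/2) ^ N * (fdiff ^^ N) g (real n))) sums ?H 0"
    by (simp only: euler_sum_step)
  have "(\<lambda>n. 2 * ((-1) ^ n * g (real n))) sums (2 * S)"
    using assms(1) by (rule sums_mult)
  from sums_diff[OF this T] show ?thesis
    by (simp add: algebra_simps)
qed

section \<open>Differences of the Gaussian and the error of the Euler transformation\<close>

lemma fdiff_funpow_deriv:
  assumes "\<And>k x. (G k has_real_derivative G (Suc k) x) (at x)"
  shows "((fdiff ^^ j) (G k) has_real_derivative (fdiff ^^ j) (G (Suc k)) x) (at x)"
proof (induction j arbitrary: x)
  case (Suc j)
  have "((\<lambda>x. (fdiff ^^ j) (G k) (x + 1)) has_real_derivative (fdiff ^^ j) (G (Suc k)) (x + 1)) (at x)"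
    using Suc[of "x + 1"] by (simp add: DERIV_shift)
  from DERIV_diff[OF Suc[of x] this] show ?case
    by (simp only: fdiff_funpow_Suc [abs_def])
qed (use assms in simp)

text \<open>The mean value theorem trades each difference for a derivative at a point further to the
  right. As \<open>B\<close> is decreasing, the bound there carries back to
  \<open>x\<close>.\<close>

lemma abs_fdiff_funpow_le:
  assumes deriv: "\<And>k x. (G k has_real_derivative G (Suc k) x) (at x)"
    and bound: "\<And>x. x \<ge> 0 \<Longrightarrow> \<bar>G (j + k) x\<bar> \<le> B x"
    and anti: "\<And>x y. 0 \<le> x \<Longrightarrow> x \<le> y \<Longrightarrow> B y \<le> (B x :: real)"
    and "x \<ge> 0"
  shows "\<bar>(fdiff ^^ j) (G k) x\<bar> \<le> B x"
  using bound \<open>x \<ge> 0\<close>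
proof (induction j arbitrary: x k)
  case (Suc j)
  obtain \<xi> where \<xi>: "x < \<xi>" "\<xi> < x + 1"
    "(fdiff ^^ j) (G k) (x + 1) - (fdiff ^^ j) (G k) x = (x + 1 - x) * (fdiff ^^ j) (G (Suc k)) \<xi>"
    using MVT2[of x "x + 1" "(fdiff ^^ j) (G k)" "(fdiff ^^ j) (G (Suc k))"]
      fdiff_funpow_deriv[of G, OF deriv] by auto
  have "\<bar>(fdiff ^^ Suc j) (G k) x\<bar> = \<bar>(fdiff ^^ j) (G (Suc k)) \<xi>\<bar>"
    unfolding fdiff_funpow_Suc using \<xi>(3) by simp
  also have "\<dots> \<le> B \<xi>" using \<xi>(1) Suc.prems by (intro Suc.IH) auto
  also have "\<dots> \<le> B x" using \<xi>(1) Suc.prems by (intro anti) auto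
  finally show ?case .
qed auto

text \<open>These are \<open>(-1) ^ n\<close> times the Hermite polynomials, in the form of
  Rodrigues' formula.\<close>

fun gauss_poly :: "nat \<Rightarrow> real poly" where
  "gauss_poly 0 = 1"
| "gauss_poly (Suc n) = pderiv (gauss_poly n) - [:0, 2:] * gauss_poly n"

lemma gauss_poly_deriv:
  "((\<lambda>v. poly (gauss_poly n) v * exp (- v\<^sup>2)) has_real_derivative
     poly (gauss_poly (Suc n)) v * exp (- v\<^sup>2)) (at v)"
  by (auto intro!: derivative_eq_intros poly_DERIV simp: algebra_simps)

lemma power_le_fact_exp:
  fixes x :: real
  assumes "x \<ge> 0"
  shows "x ^ n \<le> fact n * exp x"
proof -
  have "(\<Sum>k\<in>{n}. inverse (fact k) * x ^ k) \<le> exp x"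
    unfolding exp_def using summable_exp[of x] assms
    by (simp only: real_scaleR_def, intro sum_le_suminf) auto
  then show ?thesis by (simp add: field_simps)
qed

lemma abs_poly_le_exp: "\<exists>C\<ge>0. \<forall>v::real. \<bar>poly p v\<bar> \<le> C * exp \<bar>v\<bar>"
proof (intro exI conjI allI)
  let ?C = "\<Sum>i\<le>degree p. \<bar>coeff p i\<bar> * fact i"
  show "?C \<ge> 0" by (intro sum_nonneg) auto
  fix v :: real
  have "\<bar>poly p v\<bar> \<le> (\<Sum>i\<le>degree p. \<bar>coeff p i\<bar> * \<bar>v\<bar> ^ i)"
    unfolding poly_altdef by (rule order_trans[OF sum_abs]) (simp add: abs_mult power_abs)
  also have "\<dots> \<le> (\<Sum>i\<le>degree p. \<bar>coeff p i\<bar> * (fact i * exp \<bar>v\<bar>))"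
    by (intro sum_mono mult_left_mono power_le_fact_exp) auto
  finally show "\<bar>poly p v\<bar> \<le> ?C * exp \<bar>v\<bar>"
    by (simp add: sum_distrib_right mult.assoc)
qed

text \<open>Half of the Gaussian exponent absorbs the polynomial; the other half is left to provide
  decay.\<close>

lemma abs_poly_times_gauss_le: "\<exists>C\<ge>0. \<forall>v::real. \<bar>poly p v * exp (- v\<^sup>2)\<bar> \<le> C * exp (- v\<^sup>2 / 2)"
proof -
  obtain C where C: "C \<ge> 0" "\<And>v. \<bar>poly p v\<bar> \<le> C * exp \<bar>v\<bar>"
    using abs_poly_le_exp by blast
  have "\<bar>poly p v * exp (- v\<^sup>2)\<bar> \<le> (C * exp (1/2)) * exp (- v\<^sup>2 / 2)" for v
  proof -
    \<comment> \<open>This square yields \<open>\<bar>v\<bar> \<le> 1/2 + v\<^sup>2 / 2\<close>, the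
      source of the constant \<open>exp (1/2)\<close>.\<close>
    have "(\<bar>v\<bar> - 1)\<^sup>2 \<ge> 0" by simp
    then have *: "\<bar>v\<bar> - v\<^sup>2 \<le> 1/2 - v\<^sup>2 / 2" by (simp add: power2_eq_square algebra_simps)
    have "\<bar>poly p v * exp (- v\<^sup>2)\<bar> \<le> (C * exp \<bar>v\<bar>) * exp (- v\<^sup>2)"
      using C(2)[of v] by (simp add: abs_mult)
    also have "\<dots> = C * exp (\<bar>v\<bar> - v\<^sup>2)" by (simp add: exp_diff exp_minus field_simps)
    also have "\<dots> \<le> C * exp (1/2 - v\<^sup>2 / 2)" using C(1) * by (intro mult_left_mono) auto
    also have "\<dots> = (C * exp (1/2)) * exp (- v\<^sup>2 / 2)"
      by (simp add: mult.assoc flip: exp_add)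
    finally show ?thesis .
  qed
  then show ?thesis using C(1) by (intro exI[of _ "C * exp (1/2)"]) auto
qed

text \<open>Completing the square makes the function a multiple of \<open>exp (-v\<^sup>2)\<close> at \<open>v = sqrt s * (x + b/2)\<close>,
  so every derivative contributes a factor \<open>sqrt s\<close>.\<close>

lemma abs_fdiff_funpow_gauss_le:
  fixes b :: real
  assumes "b \<ge> 1"
  shows "\<exists>C\<ge>0. \<forall>s x. 0 < s \<and> s \<le> 1 \<and> 0 \<le> x \<longrightarrow>
    \<bar>(fdiff ^^ N) (\<lambda>x. exp (- (s * (x\<^sup>2 + b * x)))) x\<bar> \<le> C * sqrt s ^ N * exp (- (s * x / 2))"
proof -
  obtain C where C: "C \<ge> 0"
    "\<And>v. \<bar>poly (gauss_poly N) v * exp (- v\<^sup>2)\<bar> \<le> C * exp (- v\<^sup>2 / 2)"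
    using abs_poly_times_gauss_le by blast
  have "\<bar>(fdiff ^^ N) (\<lambda>x. exp (- (s * (x\<^sup>2 + b * x)))) x\<bar>
      \<le> (C * exp (b\<^sup>2 / 4)) * sqrt s ^ N * exp (- (s * x / 2))"
    if s: "0 < s" "s \<le> 1" and x: "0 \<le> x" for s x
  proof -
    define r where "r = sqrt s"
    have r: "r > 0" "r\<^sup>2 = s" using s by (auto simp: r_def)
    define G where "G = (\<lambda>k x. exp (s * b\<^sup>2 / 4) * r ^ k *
       (poly (gauss_poly k) (r * (x + b/2)) * exp (- (r * (x + b/2))\<^sup>2)))"
    have deriv: "(G k has_real_derivative G (Suc k) x) (at x)" for k x
    proof -
      have "((\<lambda>x. r * (x + b/2)) has_real_derivative r) (at x)"
        by (auto intro!: derivative_eq_intros)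
      from DERIV_chain2[OF gauss_poly_deriv[of k] this]
      have "((\<lambda>x. poly (gauss_poly k) (r * (x + b/2)) * exp (- (r * (x + b/2))\<^sup>2))
        has_real_derivative poly (gauss_poly (Suc k)) (r * (x + b/2)) * exp (- (r * (x + b/2))\<^sup>2) * r)
          (at x)" .
      from DERIV_cmult[OF this, of "exp (s * b\<^sup>2 / 4) * r ^ k"] show ?thesis
        unfolding G_def by (simp only: power_Suc2 mult_ac)
    qed
    have "G 0 = (\<lambda>x. exp (- (s * (x\<^sup>2 + b * x))))"
      unfolding G_def using r(2)
      by (auto simp: fun_eq_iff power_mult_distrib power2_sum field_simps simp flip: exp_add)
        (simp_all add: power2_eq_square)
    moreover have "\<bar>(fdiff ^^ N) (G 0) x\<bar> \<le> (C * exp (b\<^sup>2 / 4)) * sqrt s ^ N * exp (- (s * x / 2))"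
    proof (rule abs_fdiff_funpow_le[where G = G, OF deriv])
      fix x :: real assume x: "x \<ge> 0"
      have "s * b\<^sup>2 \<le> 1 * b\<^sup>2" using s by (intro mult_right_mono) auto
      then have e1: "exp (s * b\<^sup>2 / 4) \<le> exp (b\<^sup>2 / 4)" by simp
      \<comment> \<open>The hypothesis \<open>b \<ge> 1\<close> converts Gaussian decay into decay
        in \<open>s * x\<close> that is uniform in \<open>s\<close>, so that the bound can later be
        summed as a geometric series.\<close>
      have "1 * x \<le> b * x" using assms x by (intro mult_right_mono) auto
      also have "\<dots> \<le> (x + b/2)\<^sup>2" using x assms by (simp add: power2_sum)
      finally have "s * x \<le> s * (x + b/2)\<^sup>2" using s by simp
      then have e2: "exp (- (r * (x + b/2))\<^sup>2 / 2) \<le> exp (- (s * x / 2))"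
        using r by (simp add: power_mult_distrib)
      have "\<bar>G (N + 0) x\<bar> = exp (s * b\<^sup>2 / 4) * r ^ N *
         \<bar>poly (gauss_poly N) (r * (x + b/2)) * exp (- (r * (x + b/2))\<^sup>2)\<bar>"
        unfolding G_def using r by (simp add: abs_mult)
      also have "\<dots> \<le> exp (b\<^sup>2 / 4) * r ^ N * (C * exp (- (r * (x + b/2))\<^sup>2 / 2))"
        using C(2)[of "r * (x + b/2)"] r e1 by (intro mult_mono) auto
      also have "\<dots> \<le> exp (b\<^sup>2 / 4) * r ^ N * (C * exp (- (s * x / 2)))"
        using C(1) r e2 by (intro mult_left_mono) auto
      finally show "\<bar>G (N + 0) x\<bar> \<le> (C * exp (b\<^sup>2 / 4)) * sqrt s ^ N * exp (- (s * x / 2))"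
        by (simp add: r_def mult_ac)
    qed (use C s x in \<open>auto intro!: mult_left_mono\<close>)
    ultimately show ?thesis by simp
  qed
  then show ?thesis using C(1) by (intro exI[of _ "C * exp (b\<^sup>2 / 4)"]) auto
qed

text \<open>The \<open>N\<close>-th differences contribute \<open>sqrt s ^ N\<close>, and summing
  the factors \<open>exp (- (s * n / 2))\<close> over \<open>n\<close> costs a factor of order
  \<open>1 / s\<close>.\<close>

lemma partial_theta_euler_sum:
  fixes b :: real
  assumes "b \<ge> 1"
  shows "\<exists>C. \<forall>s. 0 < s \<and> s \<le> 1 \<longrightarrow>
    \<bar>2 * (\<Sum>n. (-1) ^ n * exp (- (s * ((real n)\<^sup>2 + b * real n))))
      - euler_sum N (\<lambda>x. exp (- (s * (x\<^sup>2 + b * x)))) 0\<bar> \<le> C * sqrt s ^ N / s"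
proof -
  obtain C where C0: "0 \<le> C \<and> (\<forall>s x. 0 < s \<and> s \<le> 1 \<and> 0 \<le> x \<longrightarrow>
      \<bar>(fdiff ^^ N) (\<lambda>x. exp (- (s * (x\<^sup>2 + b * x)))) x\<bar> \<le> C * sqrt s ^ N * exp (- (s * x / 2)))"
    using abs_fdiff_funpow_gauss_le[OF assms, of N] by (rule exE)
  have C: "C \<ge> 0"
    "0 < s \<Longrightarrow> s \<le> 1 \<Longrightarrow> 0 \<le> x \<Longrightarrow>
      \<bar>(fdiff ^^ N) (\<lambda>x. exp (- (s * (x\<^sup>2 + b * x)))) x\<bar> \<le> C * sqrt s ^ N * exp (- (s * x / 2))" for s x
    by (rule conjunct1[OF C0], rule conjunct2[OF C0, rule_format], intro conjI)
  have "\<bar>2 * (\<Sum>n. (-1) ^ n * exp (- (s * ((real n)\<^sup>2 + b * real n))))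
      - euler_sum N (\<lambda>x. exp (- (s * (x\<^sup>2 + b * x)))) 0\<bar> \<le> (6 * C) * sqrt s ^ N / s"
    if s: "0 < s" "s \<le> 1" for s
  proof -
    let ?g = "\<lambda>x. exp (- (s * (x\<^sup>2 + b * x)))"
    have geo: "summable (\<lambda>n. exp (- s) ^ n)" using s by (intro summable_geometric) auto
    have le: "\<bar>?g (real n)\<bar> \<le> exp (- s) ^ n" for n
    proof -
      have "real n \<le> b * real n" using mult_right_mono[OF assms, of "real n"] by simp
      also have "\<dots> \<le> (real n)\<^sup>2 + b * real n" by simp
      finally have "s * real n \<le> s * ((real n)\<^sup>2 + b * real n)" using s by simp
      then show ?thesis by (simp flip: exp_of_nat_mult add: mult.commute)
    qed
    have "summable (\<lambda>n. (-1) ^ n * ?g (real n))"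
      using le by (intro summable_comparison_test'[OF geo]) (auto simp: abs_mult power_abs)
    moreover have "summable (\<lambda>n. ?g (real n))"
      using le by (intro summable_comparison_test'[OF geo]) auto
    ultimately have T: "(\<lambda>n. (-1) ^ n * (2 * (1/2) ^ N * (fdiff ^^ N) ?g (real n))) sums
        (2 * (\<Sum>n. (-1) ^ n * ?g (real n)) - euler_sum N ?g 0)"
      by (intro euler_transform summable_sums summable_LIMSEQ_zero)
    have "exp (- (s/2)) < 1" using s by simp
    then have G: "(\<lambda>n. 2 * (C * sqrt s ^ N) * exp (- (s/2)) ^ n) sums
        (2 * (C * sqrt s ^ N) * (1 / (1 - exp (- (s/2)))))"
      by (intro sums_mult geometric_sums) auto
    have "norm (\<Sum>n. (-1) ^ n * (2 * (1/2) ^ N * (fdiff ^^ N) ?g (real n)))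
        \<le> (\<Sum>n. 2 * (C * sqrt s ^ N) * exp (- (s/2)) ^ n)"
    proof (rule norm_suminf_le)
      fix n
      have "norm ((-1) ^ n * (2 * (1/2) ^ N * (fdiff ^^ N) ?g (real n)))
          = (2 * (1/2) ^ N) * \<bar>(fdiff ^^ N) ?g (real n)\<bar>"
        by (simp add: abs_mult power_abs)
      also have "\<dots> \<le> 2 * (C * sqrt s ^ N * exp (- (s * real n / 2)))"
        using C(2)[OF s, of "real n"] by (intro mult_mono) (auto simp: power_le_one)
      also have "\<dots> = 2 * (C * sqrt s ^ N) * exp (- (s/2)) ^ n"
        by (simp flip: exp_of_nat_mult add: mult_ac)
      finally show "norm ((-1) ^ n * (2 * (1/2) ^ N * (fdiff ^^ N) ?g (real n)))
          \<le> 2 * (C * sqrt s ^ N) * exp (- (s/2)) ^ n" .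
    qed (use G in \<open>auto simp: sums_iff\<close>)
    also have "\<dots> = 2 * (C * sqrt s ^ N) * (1 / (1 - exp (- (s/2))))"
      using G by (simp add: sums_iff)
    also have "\<dots> \<le> 2 * (C * sqrt s ^ N) * (3 / s)"
    proof (intro mult_left_mono)
      have "1 + s/2 \<le> exp (s/2)" by (rule exp_ge_add_one_self)
      then have "exp (- (s/2)) \<le> 1 / (1 + s/2)"
        using s by (simp add: exp_minus field_simps)
      \<comment> \<open>Here \<open>s \<le> 1\<close> enters:
        \<open>(1 + s/2) * (1 - s/3) - 1 = s * (1 - s) / 6\<close>.\<close>
      also have "\<dots> \<le> 1 - s / 3" using s by (simp add: field_simps)
      finally show "1 / (1 - exp (- (s/2))) \<le> 3 / s" using s by (simp add: field_simps)
    qed (use C s in auto)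
    finally show ?thesis using sums_unique[OF T] by (simp add: mult_ac)
  qed
  then show ?thesis by blast
qed

section \<open>Asymptotic expansions and a formula for the coefficients\<close>

lemma asymp_expansion_diff:
  assumes "asymp_expansion_at_0 f a" "asymp_expansion_at_0 g c"
  shows "asymp_expansion_at_0 (\<lambda>t. f t - g t) (\<lambda>n. a n - c n)"
  unfolding asymp_expansion_at_0_def
proof
  fix N
  have "(\<lambda>t. (f t - (\<Sum>n\<le>N. a n * t ^ n)) - (g t - (\<Sum>n\<le>N. c n * t ^ n))) \<in> O[at_right 0](\<lambda>t. t ^ (N + 1))"
    using assms[unfolded asymp_expansion_at_0_def, rule_format, of N] by (rule sum_in_bigo(2))
  then show "(\<lambda>t. (f t - g t) - (\<Sum>n\<le>N. (a n - c n) * t ^ n)) \<in> O[at_right 0](\<lambda>t. t ^ (N + 1))"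
    by (simp add: sum_subtractf left_diff_distrib algebra_simps)
qed

lemma asymp_expansion_sum_cmult:
  assumes "\<And>j. j \<in> A \<Longrightarrow> asymp_expansion_at_0 (f j) (a j)"
  shows "asymp_expansion_at_0 (\<lambda>t. \<Sum>j\<in>A. c j * f j t) (\<lambda>n. \<Sum>j\<in>A. c j * a j n)"
  unfolding asymp_expansion_at_0_def
proof
  fix N
  have "(\<lambda>t. \<Sum>j\<in>A. c j * (f j t - (\<Sum>n\<le>N. a j n * t ^ n))) \<in> O[at_right 0](\<lambda>t. t ^ (N + 1))"
    using assms unfolding asymp_expansion_at_0_def
    by (intro big_sum_in_bigo) simp
  also have "(\<lambda>t. \<Sum>j\<in>A. c j * (f j t - (\<Sum>n\<le>N. a j n * t ^ n)))
      = (\<lambda>t. (\<Sum>j\<in>A. c j * f j t) - (\<Sum>n\<le>N. (\<Sum>j\<in>A. c j * a j n) * t ^ n))"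
    by (simp add: right_diff_distrib sum_subtractf sum_distrib_left sum_distrib_right
        sum.swap[of _ A] mult.assoc)
  finally show "(\<lambda>t. (\<Sum>j\<in>A. c j * f j t) - (\<Sum>n\<le>N. (\<Sum>j\<in>A. c j * a j n) * t ^ n))
      \<in> O[at_right 0](\<lambda>t. t ^ (N + 1))" .
qed

lemma asymp_expansion_fdiff_funpow:
  assumes "\<And>x. asymp_expansion_at_0 (\<lambda>t. G t x) (\<lambda>n. P n x)"
  shows "asymp_expansion_at_0 (\<lambda>t. (fdiff ^^ j) (G t) x) (\<lambda>n. (fdiff ^^ j) (P n) x)"
proof (induction j arbitrary: x)
  case (Suc j)
  show ?case
    unfolding fdiff_funpow_Suc by (intro asymp_expansion_diff Suc)
qed (use assms in simp)

lemma asymp_expansion_euler_sum: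
  assumes "\<And>x. asymp_expansion_at_0 (\<lambda>t. G t x) (\<lambda>n. P n x)"
  shows "asymp_expansion_at_0 (\<lambda>t. euler_sum N (G t) x) (\<lambda>n. euler_sum N (P n) x)"
  unfolding euler_sum_def
  by (intro asymp_expansion_sum_cmult asymp_expansion_fdiff_funpow assms)

text \<open>Uniqueness of asymptotic coefficients: the limit at 0 kills the constant term, then a
  factor \<open>t\<close> cancels.\<close>

lemma poly_bigo_imp_zero:
  fixes d :: "nat \<Rightarrow> real"
  assumes "(\<lambda>t. \<Sum>k<n. d k * t ^ k) \<in> O[at_right 0](\<lambda>t. t ^ n)" "k < n"
  shows "d k = 0"
  using assms
proof (induction n arbitrary: d k)
  case (Suc n)
  let ?f = "\<lambda>t. \<Sum>k<Suc n. d k * t ^ k" and ?g = "\<lambda>t. \<Sum>k<n. d (Suc k) * t ^ k"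
  have eq: "?f t = d 0 + t * ?g t" for t
    by (subst sum.lessThan_Suc_shift) (simp add: sum_distrib_left mult_ac)
  have "((\<lambda>t::real. t ^ Suc n) \<longlongrightarrow> 0) (at_right 0)"
    by (auto intro!: tendsto_eq_intros)
  then have "(\<lambda>t::real. t ^ Suc n) \<in> o[at_right 0](\<lambda>_. 1)"
    by (intro smalloI_tendsto) auto
  with Suc.prems(1) have "?f \<in> o[at_right 0](\<lambda>_. 1)"
    by (rule landau_o.big_small_trans)
  then have "(?f \<longlongrightarrow> 0) (at_right 0)"
    using smalloD_tendsto by fastforce
  moreover have "(?f \<longlongrightarrow> (\<Sum>k<Suc n. d k * 0 ^ k)) (at_right 0)"
    by (intro tendsto_intros)
  moreover have "(\<Sum>k<Suc n. d k * 0 ^ k) = d 0"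
    using eq[of 0] by simp
  ultimately have d0: "d 0 = 0"
    using tendsto_unique[OF trivial_limit_at_right_real] by metis
  have "(\<lambda>t. t * ?g t) \<in> O[at_right 0](\<lambda>t. t * t ^ n)"
    using Suc.prems(1) by (simp only: eq d0 power_Suc) simp
  then have "?g \<in> O[at_right 0](\<lambda>t. t ^ n)"
    by (subst (asm) landau_o.big.mult_cancel_left) (auto simp: eventually_at_right_field intro: exI[of _ 1])
  from Suc.IH[OF this] d0 Suc.prems(2) show ?case by (cases k) auto
next
  case 0
  from 0(2) show ?case by (simp only: not_less_zero)
qed

text \<open>This puts \<open>s\<close> into the range \<open>0 < s \<le> 1\<close> of the error
  estimate and turns powers of \<open>s\<close> into powers of \<open>t\<close>.\<close>

lemma neg_log_q_bounds:
  assumes "0 < t" "t \<le> 1/4"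
  shows "0 < neg_log_q t" "neg_log_q t \<le> 4 * t"
proof -
  have "(1 - t) / (1 + t) < 1" "(1 - t) / (1 + t) > 0" using assms by auto
  then show "0 < neg_log_q t" by (simp add: neg_log_q_def qpar_def)
  have "neg_log_q t = ln ((1 + t) / (1 - t))"
    using assms by (simp add: neg_log_q_def qpar_def ln_div)
  also have "\<dots> \<le> (1 + t) / (1 - t) - 1"
    using assms by (intro ln_le_minus_one) auto
  also have "\<dots> \<le> 4 * t" using assms by (simp add: field_simps)
  finally show "neg_log_q t \<le> 4 * t" .
qed

lemma f_theta_eq:
  assumes "0 < t" "t \<le> 1/4"
  shows "f_theta b t =
    2 * (\<Sum>n. (-1) ^ n * exp (- (neg_log_q t * ((real n)\<^sup>2 + real b * real n))))"
proof -
  have "qpar t > 0" using assms by (simp add: qpar_def)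
  then have "qpar t ^ k = exp (- (neg_log_q t * real k))" for k
    by (simp add: neg_log_q_def mult.commute exp_of_nat_mult)
  then show ?thesis by (simp add: f_theta_def)
qed

text \<open>The order \<open>2 * (n + 2)\<close> is chosen so that the error
  \<open>sqrt s ^ (2 * (n + 2)) / s\<close> equals \<open>s ^ (n + 1)\<close>.\<close>

lemma f_theta_euler_sum_bigo:
  assumes "b > 0"
  shows "(\<lambda>t. f_theta b t - euler_sum (2 * (n + 2)) (\<lambda>x. exp (- (x\<^sup>2 + real b * x) * neg_log_q t)) 0)
    \<in> O[at_right 0](\<lambda>t. t ^ (n + 1))"
proof -
  have "real b \<ge> 1" using assms by simp
  from partial_theta_euler_sum[OF this, of "2 * (n + 2)"]
  obtain C where C: "\<forall>s. 0 < s \<and> s \<le> 1 \<longrightarrow>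
    \<bar>2 * (\<Sum>n. (-1) ^ n * exp (- (s * ((real n)\<^sup>2 + real b * real n))))
      - euler_sum (2 * (n + 2)) (\<lambda>x. exp (- (s * (x\<^sup>2 + real b * x)))) 0\<bar> \<le> C * sqrt s ^ (2 * (n + 2)) / s"
    by (rule exE)
  show ?thesis
  proof (rule bigoI)
    show "\<forall>\<^sub>F t in at_right 0.
      norm (f_theta b t - euler_sum (2 * (n + 2)) (\<lambda>x. exp (- (x\<^sup>2 + real b * x) * neg_log_q t)) 0)
        \<le> (\<bar>C\<bar> * 4 ^ (n + 1)) * norm (t ^ (n + 1))"
      unfolding eventually_at_right_field
    proof (intro exI[of _ "1/4"] conjI allI impI)
      fix t :: real assume t: "0 < t" "t < 1/4"
      let ?s = "neg_log_q t"
      have s: "0 < ?s" "?s \<le> 4 * t" using neg_log_q_bounds[of t] t by auto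
      then have s1: "?s \<le> 1" using t by simp
      have "norm (f_theta b t - euler_sum (2 * (n + 2)) (\<lambda>x. exp (- (x\<^sup>2 + real b * x) * ?s)) 0)
        \<le> C * sqrt ?s ^ (2 * (n + 2)) / ?s"
      proof -
        have "- (x\<^sup>2 + real b * x) * ?s = - (?s * (x\<^sup>2 + real b * x))" for x
          by (simp add: algebra_simps)
        then show ?thesis
          using C[rule_format, of ?s] s s1 t by (simp only: f_theta_eq real_norm_def)
      qed
      also have "\<dots> = C * ?s ^ (n + 1)"
      proof -
        have "sqrt ?s ^ (2 * (n + 2)) = ?s ^ (n + 1) * ?s"
          unfolding power_mult using s by simp
        then show ?thesis using s by simp
      qed
      also have "\<dots> \<le> \<bar>C\<bar> * (4 * t) ^ (n + 1)"
        using s by (intro mult_mono power_mono) auto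
      finally show "norm (f_theta b t - euler_sum (2 * (n + 2)) (\<lambda>x. exp (- (x\<^sup>2 + real b * x) * ?s)) 0)
        \<le> (\<bar>C\<bar> * 4 ^ (n + 1)) * norm (t ^ (n + 1))"
        using t by (simp add: power_mult_distrib abs_mult power_abs mult_ac)
    qed simp
  qed
qed

text \<open>For fixed \<open>n\<close> the finite Euler sum agrees with \<open>f_theta b\<close> up
  to \<open>O(t ^ (n + 1))\<close>, and it can be expanded term by term. Uniqueness then identifies
  the coefficients up to index \<open>n\<close>.\<close>

lemma f_theta_coeff:
  assumes "b > 0" and a: "asymp_expansion_at_0 (f_theta b) a"
  shows "a n = euler_sum (2 * (n + 2)) (\<lambda>x. ml_coeff n (- (x\<^sup>2 + real b * x))) 0"
proof -
  let ?N = "2 * (n + 2)"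
  define c where "c k = euler_sum ?N (\<lambda>x. ml_coeff k (- (x\<^sup>2 + real b * x))) 0" for k
  let ?E = "\<lambda>t. euler_sum ?N (\<lambda>x. exp (- (x\<^sup>2 + real b * x) * neg_log_q t)) 0"
  have "asymp_expansion_at_0 ?E c"
    unfolding c_def by (intro asymp_expansion_euler_sum exp_neg_log_q_expansion)
  then have "(\<lambda>t. ?E t - (\<Sum>k\<le>n. c k * t ^ k)) \<in> O[at_right 0](\<lambda>t. t ^ (n + 1))"
    by (simp add: asymp_expansion_at_0_def)
  moreover have "(\<lambda>t. f_theta b t - (\<Sum>k\<le>n. a k * t ^ k)) \<in> O[at_right 0](\<lambda>t. t ^ (n + 1))"
    using a by (simp add: asymp_expansion_at_0_def)
  ultimately have "(\<lambda>t. (f_theta b t - ?E t) + (?E t - (\<Sum>k\<le>n. c k * t ^ k))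
      - (f_theta b t - (\<Sum>k\<le>n. a k * t ^ k))) \<in> O[at_right 0](\<lambda>t. t ^ (n + 1))"
    by (rule sum_in_bigo(2)[OF sum_in_bigo(1)[OF f_theta_euler_sum_bigo[OF assms(1)]]])
  also have "(\<lambda>t. (f_theta b t - ?E t) + (?E t - (\<Sum>k\<le>n. c k * t ^ k))
      - (f_theta b t - (\<Sum>k\<le>n. a k * t ^ k))) = (\<lambda>t. \<Sum>k<n + 1. (a k - c k) * t ^ k)"
    by (simp add: left_diff_distrib sum_subtractf lessThan_Suc_atMost)
  finally have "a n - c n = 0"
    by (rule poly_bigo_imp_zero) simp
  then show ?thesis by (simp add: c_def)
qed

section \<open>The functional on polynomials\<close>

lemma fdiff_poly: "fdiff (poly P) = poly (P - pcompose P [:1, 1:])"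
  by (auto simp: fdiff_def poly_pcompose add.commute)

lemma degree_poly_fdiff:
  fixes P :: "real poly"
  assumes "degree P > 0"
  shows "degree (P - pcompose P [:1, 1:]) < degree P"
proof -
  let ?Q = "pcompose P [:1, 1:]"
  have "degree ?Q = degree P" by (simp add: degree_pcompose)
  moreover have "lead_coeff ?Q = lead_coeff P" by (subst lead_coeff_comp) auto
  ultimately have "coeff (P - ?Q) (degree P) = 0" "degree (P - ?Q) \<le> degree P"
    using degree_diff_le_max[of P ?Q] by auto
  then show ?thesis using assms
    by (metis degree_0 eq_zero_or_degree_less)
qed

lemma fdiff_funpow_poly_eq_0:
  assumes "degree P < N"
  shows "(fdiff ^^ N) (poly P) = (\<lambda>_. 0)"
  using assms
proof (induction N arbitrary: P)
  case (Suc N)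
  let ?R = "P - pcompose P [:1, 1:]"
  have *: "(fdiff ^^ Suc N) (poly P) = (fdiff ^^ N) (poly ?R)"
    by (simp only: funpow_Suc_right o_apply fdiff_poly)
  show ?case
  \<comment> \<open>Differencing lowers only a positive degree. A constant is sent to the zero
    polynomial, which stays zero from then on.\<close>
  proof (cases "degree P = 0")
    case True
    then have "?R = 0" by (auto elim: degree_eq_zeroE)
    have "(fdiff ^^ N) (poly 0) = (\<lambda>_. 0)"
    proof (cases N)
      case (Suc M)
      then have "degree (0 :: real poly) < N" by simp
      then show ?thesis by (rule Suc.IH)
    qed (simp add: fun_eq_iff)
    with \<open>?R = 0\<close> have "(fdiff ^^ N) (poly ?R) = (\<lambda>_. 0)" by (simp only:)
    with * show ?thesis by simp
  next
    case False
    with Suc.prems degree_poly_fdiff[of P] have "degree ?R < N" by simp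
    with * show ?thesis using Suc.IH by simp
  qed
qed simp

lemma euler_sum_poly_step:
  assumes "degree P < N"
  shows "euler_sum N (poly P) x + euler_sum N (poly P) (x + 1) = 2 * poly P x"
  using euler_sum_step[of N "poly P" x] fdiff_funpow_poly_eq_0[OF assms] by simp

text \<open>Below order \<open>N\<close> the Euler sum satisfies
  \<open>L (x + 1) = 2 P x - L x\<close> exactly; this is unrolled \<open>m\<close> times.\<close>

lemma euler_sum_poly_shift:
  assumes "degree P < N"
  shows "euler_sum N (poly P) (real m)
    = (-1) ^ m * (euler_sum N (poly P) 0 - 2 * (\<Sum>i<m. (-1) ^ i * poly P (real i)))"
proof (induction m)
  case (Suc m)
  have "euler_sum N (poly P) (real (Suc m)) = 2 * poly P (real m) - euler_sum N (poly P) (real m)"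
    using euler_sum_poly_step[OF assms, of "real m"] by (simp add: add.commute)
  with Suc show ?case
    by (simp add: algebra_simps flip: power_add mult_2)
qed simp

lemma euler_sum_translate: "euler_sum N (\<lambda>x. g (x + c)) x = euler_sum N g (x + c)"
  by (simp add: euler_sum_def fdiff_funpow_shift)

lemma fdiff_funpow_sum_cmult:
  "(fdiff ^^ j) (\<lambda>x. \<Sum>i\<in>A. c i * g i x) = (\<lambda>x. \<Sum>i\<in>A. c i * (fdiff ^^ j) (g i) x)"
proof (induction j)
  case (Suc j)
  show ?case
    by (rule ext) (simp only: fdiff_funpow_Suc Suc right_diff_distrib sum_subtractf)
qed simp

lemma euler_sum_sum_cmult:
  "euler_sum N (\<lambda>x. \<Sum>i\<in>A. c i * g i x) x = (\<Sum>i\<in>A. c i * euler_sum N (g i) x)"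
  unfolding euler_sum_def fdiff_funpow_sum_cmult
  by (simp add: sum_distrib_left sum.swap[of _ A] mult_ac)

lemma fdiff_funpow_is_poly: "\<exists>Q. (fdiff ^^ j) (poly P) = poly Q"
proof (induction j)
  case (Suc j)
  then obtain Q where "(fdiff ^^ j) (poly P) = poly Q" by blast
  then have "(fdiff ^^ Suc j) (poly P) = poly (Q - pcompose Q [:1, 1:])"
    by (simp only: funpow.simps o_apply fdiff_poly)
  then show ?case by blast
qed auto

lemma euler_sum_is_poly: "\<exists>Q. euler_sum N (poly P) = poly Q"
proof -
  obtain Q where Q: "\<And>j. (fdiff ^^ j) (poly P) = poly (Q j)"
    using fdiff_funpow_is_poly[of _ P] by metis
  have "euler_sum N (poly P) = poly (\<Sum>j<N. smult ((1/2) ^ j) (Q j))"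
    by (rule ext) (simp add: euler_sum_def Q poly_sum)
  then show ?thesis by blast
qed

text \<open>Each difference doubles such an \<open>R\<close>, yet sufficiently many differences
  annihilate any polynomial.\<close>

lemma poly_anti_periodic_eq_0:
  assumes "\<And>x. poly R (x + 1) = - poly R (x :: real)"
  shows "poly R x = 0"
proof -
  have "(fdiff ^^ j) (poly R) = (\<lambda>x. 2 ^ j * poly R x)" for j
  proof (induction j)
    case (Suc j)
    show ?case by (rule ext) (simp only: fdiff_funpow_Suc Suc assms, simp)
  qed simp
  from this[of "Suc (degree R)"] have "2 ^ Suc (degree R) * poly R x = 0"
    using fdiff_funpow_poly_eq_0[of R "Suc (degree R)"] by (metis lessI)
  then show ?thesis by simp
qed

text \<open>For even \<open>P\<close> the combination \<open>L x + L (- x) - 2 P x\<close> changes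
  sign under \<open>x \<mapsto> x + 1\<close>, hence vanishes; it is then evaluated at 0.\<close>

lemma euler_sum_even_poly:
  assumes deg: "degree P < N" and even: "\<And>x. poly P (- x) = poly P x"
  shows "euler_sum N (poly P) 0 = poly P 0"
proof -
  let ?L = "euler_sum N (poly P)"
  obtain Q where Q: "?L = poly Q" using euler_sum_is_poly by blast
  define R where "R = Q + pcompose Q [:0, -1:] - smult 2 P"
  have R: "poly R x = ?L x + ?L (- x) - 2 * poly P x" for x
    by (simp add: R_def poly_pcompose Q)
  have "poly R (x + 1) = - poly R x" for x
  proof -
    have "?L x + ?L (x + 1) = 2 * poly P x" by (rule euler_sum_poly_step[OF deg])
    moreover have "?L (- x - 1) + ?L (- x) = 2 * poly P (x + 1)"
      using euler_sum_poly_step[OF deg, of "- x - 1"] even[of "x + 1"] by simp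
    moreover have "- (x + 1) = - x - 1" by simp
    ultimately show ?thesis unfolding R by (simp only:)
  qed
  from poly_anti_periodic_eq_0[of R, OF this, of 0] show ?thesis by (simp add: R)
qed

section \<open>Euler numbers and the secant series\<close>

text \<open>This is the Euler polynomial of degree \<open>n\<close> at \<open>1/2\<close>, that is,
  the Euler number divided by \<open>2 ^ n\<close>. Order \<open>Suc n\<close> is the least at which
  the truncated operator is exact on degree \<open>n\<close>.\<close>

definition euler_half :: "nat \<Rightarrow> real" where
  "euler_half n = euler_sum (Suc n) (\<lambda>y. (y + 1/2) ^ n) 0"

lemma power_shift_poly: "(\<lambda>y::real. (y + c) ^ n) = poly ([:c, 1:] ^ n)"
  by (simp add: fun_eq_iff poly_power add.commute)

lemma degree_power_shift: "degree ([:c, 1:] ^ n :: real poly) = n"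
  by (simp add: degree_power_eq)

lemma euler_sum_half:
  assumes "n < N"
  shows "euler_sum N (\<lambda>y. (y + 1/2) ^ n) 0 = euler_half n"
  unfolding euler_half_def euler_sum_def
proof (rule sum.mono_neutral_right)
  show "\<forall>i\<in>{..<N} - {..<Suc n}. (1 / 2) ^ i * (fdiff ^^ i) (\<lambda>y. (y + 1 / 2) ^ n) 0 = 0"
    by (auto simp: power_shift_poly fdiff_funpow_poly_eq_0 degree_power_shift)
qed (use assms in auto)

text \<open>The relation \<open>L g + L (\<lambda>y. g (y + 1)) = 2 g 0\<close> for
  \<open>g y = y ^ n\<close>, with both \<open>y\<close> and \<open>y + 1\<close> expanded in powers
  of \<open>y + 1/2\<close>. The right-hand side is 2 for \<open>n = 0\<close>, since
  \<open>0 ^ 0 = 1\<close>.\<close>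

lemma euler_half_recurrence:
  "(\<Sum>i\<le>n. real (n choose i) * ((-1/2) ^ (n - i) + (1/2) ^ (n - i)) * euler_half i) = 2 * 0 ^ n"
proof -
  let ?N = "Suc n"
  have binom: "euler_sum ?N (\<lambda>y. (y + (1/2 + c)) ^ n) 0
      = (\<Sum>i\<le>n. (real (n choose i) * c ^ (n - i)) * euler_half i)" for c
  proof -
    have "(\<lambda>y. (y + (1/2 + c)) ^ n) = (\<lambda>y. \<Sum>i\<le>n. (real (n choose i) * c ^ (n - i)) * (y + 1/2) ^ i)"
      by (rule ext) (simp add: binomial_ring mult_ac flip: add.assoc)
    then show ?thesis
      by (simp only: euler_sum_sum_cmult) (simp add: euler_sum_half)
  qed
  have "euler_sum ?N (poly ([:0, 1:] ^ n)) 0 + euler_sum ?N (poly ([:0, 1:] ^ n)) (0 + 1) = 2 * 0 ^ n"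
    by (subst euler_sum_poly_step) (simp_all add: degree_power_shift poly_power)
  moreover have "euler_sum ?N (poly ([:0, 1:] ^ n)) 0 = euler_sum ?N (\<lambda>y. (y + (1/2 + (-1/2))) ^ n) 0"
    by (simp flip: power_shift_poly)
  moreover have "euler_sum ?N (poly ([:0, 1:] ^ n)) (0 + 1) = euler_sum ?N (\<lambda>y. (y + (1/2 + 1/2)) ^ n) 0"
    unfolding euler_sum_translate[symmetric] by (simp flip: power_shift_poly)
  ultimately show ?thesis
    by (simp only: binom) (simp add: algebra_simps sum.distrib)
qed

text \<open>These are the numbers \<open>\<bar>E\<^sub>2\<^sub>k\<bar> / 4 ^ k\<close>, with \<open>E\<^sub>n\<close> the Euler numbers.\<close>

definition sec_coeff :: "nat \<Rightarrow> real" where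
  "sec_coeff k = (-1) ^ k * euler_half (2 * k)"

definition fps_sec_half :: "real fps" where
  "fps_sec_half = Abs_fps (\<lambda>n. if even n then sec_coeff (n div 2) / fact n else 0)"

text \<open>For even \<open>n = 2 * k\<close> the coefficient of the product is
  \<open>(-1) ^ k / (2 * fact n)\<close> times the sum in \<open>euler_half_recurrence\<close>; the
  bracket there vanishes for odd \<open>n - i\<close>, as the cosine coefficients do. For odd
  \<open>n\<close> all products vanish by parity.\<close>

lemma fps_sec_half_mult_cos: "fps_sec_half * fps_cos (1/2) = 1"
proof (rule fps_ext)
  fix n
  show "fps_nth (fps_sec_half * fps_cos (1/2)) n = fps_nth 1 n"
  proof (cases "even n")
    case False
    then have "fps_nth (fps_sec_half * fps_cos (1/2)) n = 0"
      unfolding fps_mult_nth by (intro sum.neutral) (auto simp: fps_sec_half_def fps_cos_def)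
    then show ?thesis using False by (auto elim: oddE)
  next
    case True
    then obtain k where k: "n = 2 * k" by (elim evenE)
    have "fps_nth fps_sec_half i * fps_nth (fps_cos (1/2)) (n - i) = (-1) ^ k / (2 * fact n) *
        (real (n choose i) * ((-1/2) ^ (n - i) + (1/2) ^ (n - i)) * euler_half i)" if "i \<le> n" for i
    proof (cases "even i")
      case False
      then have "odd (n - i)" using True that by simp
      then show ?thesis using False by (simp add: fps_sec_half_def power_minus_odd)
    next
      case e: True
      then obtain j where j: "i = 2 * j" by (elim evenE)
      have jk: "j \<le> k" "n - i = 2 * (k - j)" using that j k by auto
      have "(-1) ^ j * (-1) ^ (k - j) = ((-1) ^ k :: real)"
        using jk(1) by (simp flip: power_add)
      moreover have "real (n choose i) = fact n / (fact i * fact (n - i))"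
        using that by (simp add: binomial_fact)
      ultimately show ?thesis
        using jk by (simp add: fps_sec_half_def fps_cos_def sec_coeff_def j power_minus_even field_simps)
    qed
    then have "fps_nth (fps_sec_half * fps_cos (1/2)) n = (-1) ^ k / (2 * fact n) * (\<Sum>i\<le>n.
        real (n choose i) * ((-1/2) ^ (n - i) + (1/2) ^ (n - i)) * euler_half i)"
      unfolding fps_mult_nth by (simp add: sum_distrib_left atLeast0AtMost)
    then show ?thesis by (simp only: euler_half_recurrence) (simp add: k)
  qed
qed

text \<open>With \<open>S = sec (u/2)\<close> and \<open>T = tan (u/2)\<close>, the equations \<open>2 S' = S T\<close> and \<open>2 T' = 1 + T\<^sup>2\<close>
  become recurrences with nonnegative terms.\<close>

lemma fps_nth_sec_tan_half:
  defines "T \<equiv> fps_sin (1/2) * fps_sec_half"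
  shows "real (Suc n) * fps_nth fps_sec_half (Suc n)
      = 1/2 * (\<Sum>i\<le>n. fps_nth fps_sec_half i * fps_nth T (n - i))"
    and "real (Suc n) * fps_nth T (Suc n)
      = 1/2 * ((if n = 0 then 1 else 0) + (\<Sum>i\<le>n. fps_nth T i * fps_nth T (n - i)))"
proof -
  let ?S = fps_sec_half and ?C = "fps_cos (1/2 :: real)" and ?N = "fps_sin (1/2 :: real)"
  have SC: "?S * ?C = 1" by (rule fps_sec_half_mult_cos)
  have "fps_deriv (?S * ?C) = 0" by (simp add: SC)
  then have dSC: "fps_deriv ?S * ?C = fps_const (1/2) * ?S * ?N"
    by (simp add: fps_cos_deriv algebra_simps flip: fps_const_neg)
  \<comment> \<open>Multiplying the derivative of \<open>S C = 1\<close> by \<open>S\<close> clears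
    the cosine and isolates \<open>S'\<close>.\<close>
  have "fps_deriv ?S * (?S * ?C) = (fps_deriv ?S * ?C) * ?S"
    by (simp only: mult_ac)
  also have "\<dots> = fps_const (1/2) * (?S * (?N * ?S))"
    unfolding dSC by (simp only: mult_ac)
  finally have "fps_deriv ?S * (?S * ?C) = fps_const (1/2) * (?S * (?N * ?S))" .
  then have dS: "fps_deriv ?S = fps_const (1/2) * (?S * T)"
    by (simp add: SC T_def)
  have "fps_deriv T = fps_const (1/2) * (?S * ?C) + fps_const (1/2) * (T * (?N * ?S))"
    unfolding T_def fps_deriv_mult dS fps_sin_deriv by (simp only: T_def mult_ac add_ac)
  then have dT: "fps_deriv T = fps_const (1/2) * (1 + T * T)"
    by (simp only: SC T_def distrib_left)
  show "real (Suc n) * fps_nth ?S (Suc n) = 1/2 * (\<Sum>i\<le>n. fps_nth ?S i * fps_nth T (n - i))"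
    using arg_cong[OF dS, of "\<lambda>F. fps_nth F n"]
    by (simp only: fps_deriv_nth fps_mult_left_const_nth fps_mult_nth[of ?S T] atLeast0AtMost Suc_eq_plus1)
  show "real (Suc n) * fps_nth T (Suc n)
      = 1/2 * ((if n = 0 then 1 else 0) + (\<Sum>i\<le>n. fps_nth T i * fps_nth T (n - i)))"
    using arg_cong[OF dT, of "\<lambda>F. fps_nth F n"]
    by (simp only: fps_deriv_nth fps_mult_left_const_nth fps_mult_nth[of T T] atLeast0AtMost Suc_eq_plus1
        fps_add_nth fps_one_nth)
qed

lemma fps_tan_half_nonneg: "fps_nth (fps_sin (1/2) * fps_sec_half) n \<ge> 0"
proof (induction n rule: less_induct)
  case (less n)
  show ?case
  proof (cases n)
    case (Suc m)
    have "real (Suc m) * fps_nth (fps_sin (1/2) * fps_sec_half) (Suc m) \<ge> 0"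
      unfolding fps_nth_sec_tan_half(2)
      using less Suc by (intro mult_nonneg_nonneg add_nonneg_nonneg sum_nonneg) auto
    then show ?thesis unfolding Suc by (simp add: zero_le_mult_iff)
  qed (simp add: fps_sin_def)
qed

lemma fps_sec_half_0: "fps_nth fps_sec_half 0 = 1"
  using arg_cong[OF fps_sec_half_mult_cos, of "\<lambda>F. fps_nth F 0"] by (simp add: fps_cos_def)

lemma fps_sec_half_nonneg: "fps_nth fps_sec_half n \<ge> 0"
proof (induction n rule: less_induct)
  case (less n)
  show ?case
  proof (cases n)
    case (Suc m)
    have "real (Suc m) * fps_nth fps_sec_half (Suc m) \<ge> 0"
      unfolding fps_nth_sec_tan_half(1)
      using less Suc by (intro mult_nonneg_nonneg sum_nonneg fps_tan_half_nonneg) auto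
    then show ?thesis unfolding Suc by (simp add: zero_le_mult_iff)
  qed (simp add: fps_sec_half_0)
qed

lemma sec_coeff_eq: "sec_coeff k = fact (2 * k) * fps_nth fps_sec_half (2 * k)"
  by (simp add: fps_sec_half_def)

lemma sec_coeff_nonneg: "sec_coeff k \<ge> 0"
  unfolding sec_coeff_eq by (intro mult_nonneg_nonneg fps_sec_half_nonneg) simp

text \<open>In the recurrence for \<open>T\<close> only the products of two odd-index coefficients
  are kept. By induction each of these \<open>m + 1\<close> products is at least
  \<open>1/4 * (1/12) ^ m\<close>.\<close>

lemma fps_tan_half_ge: "fps_nth (fps_sin (1/2) * fps_sec_half) (2 * k + 1) \<ge> 1/2 * (1/12) ^ k"
proof (induction k rule: less_induct)
  case (less k)
  define T where "T = fps_nth (fps_sin (1/2) * fps_sec_half)"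
  have T0: "T n \<ge> 0" for n unfolding T_def by (rule fps_tan_half_nonneg)
  show ?case
  proof (cases k)
    case 0
    have "fps_nth (fps_sin (1/2) * fps_sec_half) 0 = 0" by (simp add: fps_sin_def)
    then show ?thesis using fps_nth_sec_tan_half(2)[of 0] 0 by simp
  next
    case (Suc m)
    have le: "1/2 * (1/12) ^ i * (1/2 * (1/12) ^ (m - i)) \<le> T (2 * i + 1) * T (2 * (m - i) + 1)"
      if "i \<le> m" for i
      unfolding T_def using that Suc by (intro mult_mono less.IH fps_tan_half_nonneg) auto
    have "real (m + 1) * (1/4 * (1/12) ^ m) = (\<Sum>i\<le>m. 1/2 * (1/12) ^ i * (1/2 * (1/12) ^ (m - i)))"
      by (simp flip: power_add)
    also have "\<dots> \<le> (\<Sum>i\<le>m. T (2 * i + 1) * T (2 * (m - i) + 1))"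
      using le by (intro sum_mono) auto
    \<comment> \<open>Since \<open>k = m + 1\<close>, the index complementary to
      \<open>2 * i + 1\<close> is \<open>2 * k - (2 * i + 1) = 2 * (m - i) + 1\<close>, again
      odd.\<close>
    also have "\<dots> = (\<Sum>i\<in>(\<lambda>i. 2 * i + 1) ` {..m}. T i * T (2 * k - i))"
      by (subst sum.reindex) (auto simp: inj_on_def Suc intro!: sum.cong arg_cong[of _ _ T])
    also have "\<dots> \<le> (\<Sum>i\<le>2 * k. T i * T (2 * k - i))"
      using Suc by (intro sum_mono2) (auto intro!: mult_nonneg_nonneg T0)
    also have "\<dots> = 2 * (real (Suc (2 * k)) * T (Suc (2 * k)))"
      unfolding T_def fps_nth_sec_tan_half(2) using Suc by simp
    also have "real (Suc (2 * k)) = real (2 * m + 3)" by (simp add: Suc)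
    finally have *: "real (m + 1) * (1/4 * (1/12) ^ m) \<le> 2 * (real (2 * m + 3) * T (2 * k + 1))"
      by simp
    \<comment> \<open>The ratio \<open>1/12\<close> comes from here: the claim reduces to
      \<open>2 * m + 3 \<le> 3 * (m + 1)\<close>, with equality at \<open>m = 0\<close>.\<close>
    have "real (2 * m + 3) * (1/2 * (1/12) ^ k) \<le> real (m + 1) * (1/8 * (1/12) ^ m)"
      by (simp add: Suc field_simps)
    also have "\<dots> = 1/2 * (real (m + 1) * (1/4 * (1/12) ^ m))" by simp
    also have "\<dots> \<le> 1/2 * (2 * (real (2 * m + 3) * T (2 * k + 1)))"
      using * by (rule mult_left_mono) simp
    also have "\<dots> = real (2 * m + 3) * T (2 * k + 1)" by simp
    finally show ?thesis by (simp add: T_def mult_le_cancel_left)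
  qed
qed

text \<open>Of the convolution for \<open>S'\<close> only the term \<open>i = 0\<close> is kept, so
  the bound for the tangent coefficients passes to the secant.\<close>

lemma sec_coeff_ge: "sec_coeff (Suc k) \<ge> fact (2 * k + 1) / 4 * (1/12) ^ k"
proof -
  define T where "T = fps_nth (fps_sin (1/2) * fps_sec_half)"
  have "1/2 * (1/12) ^ k \<le> fps_nth fps_sec_half 0 * T (2 * k + 1 - 0)"
    using fps_tan_half_ge[of k] by (simp add: fps_sec_half_0 T_def)
  also have "\<dots> \<le> (\<Sum>i\<le>2 * k + 1. fps_nth fps_sec_half i * T (2 * k + 1 - i))"
    unfolding T_def
    by (intro member_le_sum mult_nonneg_nonneg fps_sec_half_nonneg fps_tan_half_nonneg) auto
  also have "\<dots> = 2 * (real (2 * k + 2) * fps_nth fps_sec_half (2 * k + 2))"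
    using fps_nth_sec_tan_half(1)[of "2 * k + 1"] by (simp add: T_def)
  finally have "1/4 * (1/12) ^ k \<le> real (2 * k + 2) * fps_nth fps_sec_half (2 * k + 2)"
    by simp
  then have "fact (2 * k + 1) * (1/4 * (1/12) ^ k)
      \<le> fact (2 * k + 1) * (real (2 * k + 2) * fps_nth fps_sec_half (2 * k + 2))"
    by (intro mult_left_mono) auto
  also have "\<dots> = sec_coeff (Suc k)"
    by (simp add: sec_coeff_eq algebra_simps)
  finally show ?thesis by simp
qed

section \<open>Signs of the coefficients\<close>

text \<open>At \<open>n = k + 1\<close> the right-hand side is at least
  \<open>1/2 * fact k * (1/6) ^ k\<close> by \<open>sec_coeff_ge\<close>, while the polynomial is at
  most a constant times \<open>exp 1 ^ k\<close>.\<close>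

lemma eventually_poly_less_sec_coeff:
  assumes "C \<ge> 0"
  shows "\<forall>\<^sub>F n in sequentially. C * (real n + 1) ^ M < 2 ^ n / fact n * sec_coeff n"
proof -
  define C' where "C' = C * (fact M * exp 2)"
  \<comment> \<open>The quotient of the two bounds is \<open>2 * C' * x ^ k / fact k\<close>, a
    multiple of a term of the series of \<open>exp x\<close>, so it tends to 0.\<close>
  define x :: real where "x = 6 * exp 1"
  have "(\<lambda>k. inverse (fact k) * x ^ k) \<longlonglongrightarrow> 0"
    by (rule summable_LIMSEQ_zero[OF summable_exp])
  then have "(\<lambda>k. 2 * C' * (inverse (fact k) * x ^ k)) \<longlonglongrightarrow> 2 * C' * 0"
    by (intro tendsto_mult tendsto_const)
  then have "\<forall>\<^sub>F k in sequentially. 2 * C' * (inverse (fact k) * x ^ k) < 1"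
    by (rule order_tendstoD) simp
  then have "\<forall>\<^sub>F k in sequentially. C * (real (Suc k) + 1) ^ M < 2 ^ Suc k / fact (Suc k) * sec_coeff (Suc k)"
  proof eventually_elim
    case (elim k)
    have "C * (real (Suc k) + 1) ^ M \<le> C * (fact M * exp (real (Suc k) + 1))"
      by (intro mult_left_mono power_le_fact_exp assms) auto
    also have "exp (real (Suc k) + 1) = exp 2 * exp 1 ^ k"
      by (simp flip: exp_of_nat_mult exp_add)
    also have "C * (fact M * (exp 2 * exp 1 ^ k)) = 2 * C' * (inverse (fact k) * x ^ k) * (1/2 * (fact k * (1/6) ^ k))"
      by (simp add: C'_def x_def power_mult_distrib field_simps)
    also have "\<dots> < 1 * (1/2 * (fact k * (1/6) ^ k))"
      using elim by (intro mult_strict_right_mono) auto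
    also have "\<dots> \<le> 1/2 * ((fact (2 * k + 1) / fact (Suc k)) * (1/6) ^ k)"
    proof -
      have "fact (Suc k) * fact k dvd (fact (Suc k + k) :: nat)" by (rule fact_fact_dvd_fact)
      then have "fact (Suc k) * fact k \<le> (fact (2 * k + 1) :: nat)"
        by (intro dvd_imp_le) (simp_all add: mult_2)
      then have "real (fact (Suc k) * fact k) \<le> real (fact (2 * k + 1))" by (simp only: of_nat_le_iff)
      then have "fact k \<le> (fact (2 * k + 1) / fact (Suc k) :: real)"
        by (simp add: pos_le_divide_eq mult.commute del: fact_Suc)
      then show ?thesis unfolding mult_1 by (intro mult_left_mono mult_right_mono) auto
    qed
    also have "\<dots> = 2 ^ Suc k / fact (Suc k) * (fact (2 * k + 1) / 4 * (1/12) ^ k)"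
    proof -
      have "(1/6 :: real) ^ k = 2 ^ k * (1/12) ^ k" by (simp flip: power_mult_distrib)
      then show ?thesis by (simp add: field_simps del: fact_Suc)
    qed
    also have "\<dots> \<le> 2 ^ Suc k / fact (Suc k) * sec_coeff (Suc k)"
      by (intro mult_left_mono sec_coeff_ge) auto
    finally show ?case by simp
  qed
  then show ?thesis
    by (subst eventually_sequentially_Suc [symmetric])
qed

text \<open>For \<open>M > 0\<close> the left side is of order at most \<open>n ^ (M - 1)\<close>,
  while the right side is at least \<open>(M + n) choose M\<close>, of order \<open>n ^ M\<close>.
  For \<open>M = 0\<close> the left side vanishes once \<open>n \<ge> 1\<close>.\<close>

lemma eventually_ml_coeff_dominates:
  assumes "C \<ge> 0"
  shows "\<forall>\<^sub>F n in sequentially. C * ml_coeff n (real M) < ml_coeff n (real M + 1)"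
proof (cases M)
  case 0
  show ?thesis
  proof (rule eventually_sequentiallyI[of 1])
    fix n :: nat
    assume "1 \<le> n"
    moreover have "1 \<le> ml_coeff n 1" using ml_coeff_ge[of 0 n] by simp
    ultimately show "C * ml_coeff n (real M) < ml_coeff n (real M + 1)"
      by (simp add: 0 ml_coeff_0_right)
  qed
next
  case (Suc L)
  define K where "K = C * 2 ^ (L + 1) * real M ^ M"
  have "\<forall>\<^sub>F n in sequentially. K < real n + 1"
    using eventually_gt_at_top[of "nat \<lceil>K\<rceil>"] by eventually_elim linarith
  then show ?thesis
  proof eventually_elim
    case (elim n)
    have M: "real M > 0" using Suc by simp
    have "C * ml_coeff n (real M) \<le> C * (2 ^ (L + 1) * (real n + 1) ^ L)"
      using ml_coeff_le[of n L] Suc assms by (intro mult_left_mono) (simp_all add: add.commute)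
    also have "\<dots> = K * (real n + 1) ^ L / real M ^ M"
      using M by (simp add: K_def)
    also have "\<dots> < (real n + 1) * (real n + 1) ^ L / real M ^ M"
      using elim M by (intro divide_strict_right_mono mult_strict_right_mono) auto
    also have "\<dots> = ((real n + 1) / real M) ^ M"
      by (simp add: Suc power_divide)
    also have "\<dots> \<le> (real (M + n) / real M) ^ M"
      using M Suc by (intro power_mono divide_right_mono) auto
    also have "\<dots> \<le> real ((M + n) choose M)"
      by (intro binomial_ge_n_over_k_pow_k) simp
    also have "\<dots> = real ((M + n) choose n)"
      by (subst binomial_symmetric) auto
    also have "\<dots> \<le> ml_coeff n (real M + 1)" by (rule ml_coeff_ge)
    finally show ?case .
  qed
qed

text \<open>The inner polynomial is \<open>- (y + \<beta>)\<^sup>2\<close>. The bound is the order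
  used in \<open>f_theta_coeff\<close>, so the Euler sum is exact on this polynomial.\<close>

lemma degree_ml_poly_pcompose:
  "degree (pcompose (ml_poly c n) [:-(\<beta>\<^sup>2), -(2 * \<beta>), -1:]) < 2 * (n + 2)"
proof -
  have "degree (pcompose (ml_poly c n) [:-(\<beta>\<^sup>2), -(2 * \<beta>), -1:]) = degree (ml_poly c n) * 2"
    by (simp add: degree_pcompose)
  then show ?thesis using degree_ml_poly[of c n] by simp
qed

lemma poly_ml_poly_pcompose:
  "poly (pcompose (ml_poly c n) [:-(\<beta>\<^sup>2), -(2 * \<beta>), -1:]) y = ml_coeff n (c - (y + \<beta>)\<^sup>2)"
  by (simp add: poly_pcompose poly_ml_poly power2_eq_square algebra_simps)

text \<open>The signs \<open>(-1) ^ k\<close> from the powers of \<open>- (y + 1/2)\<^sup>2\<close>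
  turn \<open>euler_half (2 * k)\<close> into \<open>sec_coeff k\<close>. All terms are then
  nonnegative, and the one with \<open>k = n\<close> is kept, with leading coefficient
  \<open>2 ^ n / fact n\<close>.\<close>

lemma euler_sum_half_ml_poly_ge:
  assumes "c \<ge> 0"
  shows "euler_sum (2 * (n + 2)) (poly (pcompose (ml_poly c n) [:-((1/2)\<^sup>2), -(2 * (1/2)), -1:])) 0
    \<ge> 2 ^ n / fact n * sec_coeff n"
proof -
  let ?d = "coeff (ml_poly c n)"
  have "poly (pcompose (ml_poly c n) [:-((1/2)\<^sup>2), -(2 * (1/2)), -1:]) y
      = (\<Sum>k\<le>n. (?d k * (-1) ^ k) * (y + 1/2) ^ (2 * k))" for y
  proof -
    have "poly (pcompose (ml_poly c n) [:-((1/2)\<^sup>2), -(2 * (1/2)), -1:]) y = poly (ml_poly c n) (- ((y + 1/2)\<^sup>2))"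
      by (simp only: poly_ml_poly_pcompose poly_ml_poly) simp
    also have "\<dots> = (\<Sum>k\<le>n. ?d k * (- ((y + 1/2)\<^sup>2)) ^ k)"
      using degree_ml_poly[of c n] unfolding poly_altdef
      by (intro sum.mono_neutral_left) (auto intro: le_degree)
    also have "\<dots> = (\<Sum>k\<le>n. (?d k * (-1) ^ k) * (y + 1/2) ^ (2 * k))"
      by (intro sum.cong refl) (simp add: power_mult power_minus[of "(y + 1/2)\<^sup>2"])
    finally show ?thesis .
  qed
  then have "poly (pcompose (ml_poly c n) [:-((1/2)\<^sup>2), -(2 * (1/2)), -1:])
      = (\<lambda>y. \<Sum>k\<le>n. (?d k * (-1) ^ k) * (y + 1/2) ^ (2 * k))"
    by (rule ext)
  then have "euler_sum (2 * (n + 2)) (poly (pcompose (ml_poly c n) [:-((1/2)\<^sup>2), -(2 * (1/2)), -1:])) 0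
      = (\<Sum>k\<le>n. (?d k * (-1) ^ k) * euler_sum (2 * (n + 2)) (\<lambda>y. (y + 1/2) ^ (2 * k)) 0)"
    by (simp only: euler_sum_sum_cmult)
  also have "\<dots> = (\<Sum>k\<le>n. ?d k * sec_coeff k)"
    by (intro sum.cong refl) (simp add: euler_sum_half sec_coeff_def)
  also have "\<dots> \<ge> ?d n * sec_coeff n"
    using assms by (intro member_le_sum mult_nonneg_nonneg coeff_ml_poly_nonneg sec_coeff_nonneg) auto
  finally show ?thesis by (simp add: coeff_ml_poly_n)
qed

lemma abs_alternating_sum_le:
  fixes g :: "nat \<Rightarrow> real"
  assumes "\<And>i. i \<in> A \<Longrightarrow> \<bar>g i\<bar> \<le> B"
  shows "\<bar>\<Sum>i\<in>A. (-1) ^ i * g i\<bar> \<le> real (card A) * B"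
proof -
  have "\<bar>\<Sum>i\<in>A. (-1) ^ i * g i\<bar> \<le> (\<Sum>i\<in>A. \<bar>(-1) ^ i * g i\<bar>)" by (rule sum_abs)
  also have "\<dots> \<le> (\<Sum>i\<in>A. B)" using assms by (intro sum_mono) (simp add: abs_mult)
  finally show ?thesis by simp
qed

text \<open>Completing the square centres the argument at
  \<open>x = - b/2 = - (m + \<beta>)\<close>; the integer part \<open>m\<close> is removed by
  \<open>euler_sum_poly_shift\<close>. It is applied with \<open>\<beta> = 0\<close> for even
  \<open>b\<close> and \<open>\<beta> = 1/2\<close> for odd \<open>b\<close>.\<close>

lemma f_theta_coeff_shifted:
  fixes m b n :: nat and \<beta> :: real
  defines "c \<equiv> (real b)\<^sup>2 / 4"
  defines "P \<equiv> pcompose (ml_poly c n) [:-(\<beta>\<^sup>2), -(2 * \<beta>), -1:]"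
  assumes "b > 0" "asymp_expansion_at_0 (f_theta b) a" and b: "real b = 2 * real m + 2 * \<beta>"
  shows "a n = (-1) ^ m * (euler_sum (2 * (n + 2)) (poly P) 0
    - 2 * (\<Sum>i<m. (-1) ^ i * ml_coeff n (c - (real i + \<beta>)\<^sup>2)))"
proof -
  have P: "poly P y = ml_coeff n (c - (y + \<beta>)\<^sup>2)" for y
    unfolding P_def by (rule poly_ml_poly_pcompose)
  have deg: "degree P < 2 * (n + 2)"
    unfolding P_def by (rule degree_ml_poly_pcompose)
  have "- (x\<^sup>2 + real b * x) = c - (x + real m + \<beta>)\<^sup>2" for x
    unfolding c_def b by (simp add: power2_eq_square algebra_simps)
  then have "(\<lambda>x. ml_coeff n (- (x\<^sup>2 + real b * x))) = (\<lambda>x. poly P (x + real m))"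
    by (simp add: P)
  then have "a n = euler_sum (2 * (n + 2)) (poly P) (real m)"
    using f_theta_coeff[OF assms(3,4), of n] euler_sum_translate[of _ "poly P" "real m" 0] by simp
  then show ?thesis
    using euler_sum_poly_shift[OF deg, of m] by (simp only: P)
qed

lemma f_theta_coeff_even:
  assumes "m > 0" "asymp_expansion_at_0 (f_theta (2 * m)) a"
  shows "\<forall>\<^sub>F n in sequentially. (-1) ^ m * a n < 0"
proof -
  \<comment> \<open>\<open>M = m\<^sup>2 - 1\<close> is the argument at \<open>i = 1\<close>, the
    largest after \<open>m\<^sup>2\<close>. The factor \<open>2 * real m\<close> below covers the
    doubled sum of fewer than \<open>m\<close> such terms.\<close>
  obtain M where M: "m\<^sup>2 = Suc M"
    using assms(1) by (metis gr0_conv_Suc zero_less_power)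
  have M': "real M + 1 = (real m)\<^sup>2"
    using arg_cong[OF M, of real] by simp
  have "\<forall>\<^sub>F n in sequentially. (2 * real m) * ml_coeff n (real M) < ml_coeff n (real M + 1)"
    by (rule eventually_ml_coeff_dominates) simp
  then show ?thesis
  proof eventually_elim
    case (elim n)
    let ?g = "\<lambda>i. ml_coeff n ((real m)\<^sup>2 - (real i)\<^sup>2)"
    let ?P = "pcompose (ml_poly ((real m)\<^sup>2) n) [:- (0\<^sup>2), - (2 * 0), -1:]"
    have P: "poly ?P y = ml_coeff n ((real m)\<^sup>2 - y\<^sup>2)" for y
      using poly_ml_poly_pcompose[of "(real m)\<^sup>2" n 0 y] by simp
    have "euler_sum (2 * (n + 2)) (poly ?P) 0 = poly ?P 0"
      by (rule euler_sum_even_poly[OF degree_ml_poly_pcompose]) (simp only: P power2_minus)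
    then have L: "euler_sum (2 * (n + 2)) (poly ?P) 0 = ?g 0" by (simp only: P of_nat_0)
    have c: "(real (2 * m))\<^sup>2 / 4 = (real m)\<^sup>2" by (simp add: power2_eq_square)
    have "2 * m > 0" "real (2 * m) = 2 * real m + 2 * 0" using assms(1) by simp_all
    from f_theta_coeff_shifted[OF this(1) assms(2) this(2), of n]
    have a: "a n = (-1) ^ m * (?g 0 - 2 * (\<Sum>i<m. (-1) ^ i * ?g i))"
      by (simp only: c L add_0_right)
    have "{..<m} = insert 0 {1..<m}" using assms(1) by auto
    then have split: "(\<Sum>i<m. (-1) ^ i * ?g i) = ?g 0 + (\<Sum>i\<in>{1..<m}. (-1) ^ i * ?g i)"
      by simp
    have "\<bar>\<Sum>i\<in>{1..<m}. (-1) ^ i * ?g i\<bar> \<le> real (card {1..<m}) * ml_coeff n (real M)"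
    proof (rule abs_alternating_sum_le)
      fix i assume i: "i \<in> {1..<m}"
      then have "(real i)\<^sup>2 \<ge> 1" "(real i)\<^sup>2 \<le> (real m)\<^sup>2" by (auto intro: power_mono one_le_power)
      then show "\<bar>?g i\<bar> \<le> ml_coeff n (real M)"
        using ml_coeff_mono[of "(real m)\<^sup>2 - (real i)\<^sup>2" "real M" n] M' by simp
    qed
    also have "\<dots> \<le> real m * ml_coeff n (real M)"
      using ml_coeff_mono[of "real M" "real M" n] by (intro mult_right_mono) auto
    finally have "\<bar>2 * (\<Sum>i\<in>{1..<m}. (-1) ^ i * ?g i)\<bar> < ?g 0"
      using elim by (simp add: M')
    \<comment> \<open>The value \<open>g 0\<close> of the functional meets \<open>- 2 g 0\<close>
      from the index \<open>i = 0\<close>, which leaves \<open>- g 0\<close> and determines the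
      sign.\<close>
    moreover have "(-1) ^ m * a n = - (?g 0 + 2 * (\<Sum>i\<in>{1..<m}. (-1) ^ i * ?g i))"
      unfolding a split by (simp add: algebra_simps flip: power_add mult_2)
    ultimately show ?case by linarith
  qed
qed

lemma f_theta_coeff_odd:
  assumes "asymp_expansion_at_0 (f_theta (2 * m + 1)) a"
  shows "\<forall>\<^sub>F n in sequentially. (-1) ^ m * a n > 0"
proof -
  \<comment> \<open>The arguments in the finite sum are \<open>m * (m + 1) - i * (i + 1)\<close>,
    hence at most \<open>M\<close>. They are enlarged to \<open>M + 1\<close>, the form in which
    \<open>ml_coeff_le\<close> bounds them by a multiple of \<open>(n + 1) ^ M\<close>.\<close>
  define M where "M = m * (m + 1)"
  have "\<forall>\<^sub>F n in sequentially. (2 * real m * 2 ^ (M + 1)) * (real n + 1) ^ M < 2 ^ n / fact n * sec_coeff n"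
    by (rule eventually_poly_less_sec_coeff) simp
  then show ?thesis
  proof eventually_elim
    case (elim n)
    let ?c = "(real (2 * m + 1))\<^sup>2 / 4"
    let ?g = "\<lambda>i. ml_coeff n (?c - (real i + 1/2)\<^sup>2)"
    let ?L = "euler_sum (2 * (n + 2)) (poly (pcompose (ml_poly ?c n) [:-((1/2)\<^sup>2), -(2 * (1/2)), -1:])) 0"
    have a: "a n = (-1) ^ m * (?L - 2 * (\<Sum>i<m. (-1) ^ i * ?g i))"
      using assms by (intro f_theta_coeff_shifted) simp_all
    have "\<bar>\<Sum>i<m. (-1) ^ i * ?g i\<bar> \<le> real (card {..<m}) * ml_coeff n (real M + 1)"
    proof (rule abs_alternating_sum_le)
      fix i assume "i \<in> {..<m}"
      then have "real i * (real i + 1) \<le> real m * (real m + 1)" by (intro mult_mono) auto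
      moreover have "?c - (real i + 1/2)\<^sup>2 = real m * (real m + 1) - real i * (real i + 1)"
        by (simp add: power2_eq_square field_simps)
      moreover have "real m * (real m + 1) - real i * (real i + 1) \<le> real M + 1"
        by (simp add: M_def algebra_simps)
      ultimately show "\<bar>?g i\<bar> \<le> ml_coeff n (real M + 1)"
        using ml_coeff_mono[of "?c - (real i + 1/2)\<^sup>2" "real M + 1" n] by simp
    qed
    also have "\<dots> \<le> real m * (2 ^ (M + 1) * (real n + 1) ^ M)"
      using ml_coeff_le[of n M] by (simp add: mult_left_mono)
    finally have "\<bar>2 * (\<Sum>i<m. (-1) ^ i * ?g i)\<bar> < 2 ^ n / fact n * sec_coeff n"
      using elim by simp
    also have "\<dots> \<le> ?L" by (rule euler_sum_half_ml_poly_ge) simp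
    finally have "?L - 2 * (\<Sum>i<m. (-1) ^ i * ?g i) > 0" by linarith
    then show ?case
      unfolding a by (simp flip: mult.assoc power_add mult_2)
  qed
qed

theorem theorem1p1:
  fixes b :: nat and a :: "nat \<Rightarrow> real"
  assumes "b > 0"
    and "asymp_expansion_at_0 (f_theta b) a"
  shows "(b mod 4 \<in> {1, 2} \<longrightarrow> (\<forall>\<^sub>F n in sequentially. a n > 0))
       \<and> (b mod 4 \<in> {0, 3} \<longrightarrow> (\<forall>\<^sub>F n in sequentially. a n < 0))"
proof (cases "even b")
  case True
  then obtain m where m: "b = 2 * m" by (elim evenE)
  have ev: "\<forall>\<^sub>F n in sequentially. (-1) ^ m * a n < 0"
    using f_theta_coeff_even[of m a] assms by (simp add: m)
  show ?thesis
  proof (cases "even m")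
    case e: True
    then have "b mod 4 = 0" by (auto simp: m elim: evenE)
    with ev e show ?thesis by simp
  next
    case False
    then have "b mod 4 = 2" unfolding m by presburger
    with ev False show ?thesis by simp
  qed
next
  case False
  then obtain m where m: "b = 2 * m + 1" by (elim oddE)
  have ev: "\<forall>\<^sub>F n in sequentially. (-1) ^ m * a n > 0"
    using f_theta_coeff_odd[of m a] assms by (simp add: m)
  show ?thesis
  proof (cases "even m")
    case True
    then have "b mod 4 = 1" unfolding m by presburger
    with ev True show ?thesis by simp
  next
    case odd: False
    then have "b mod 4 = 3" unfolding m by presburger
    with ev odd show ?thesis by simp
  qed
qed

end
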